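(* For all constants $a>0$ and $d>0$ there exist constants $b,c,K>0$ such that the following holds. Let $n,k$ be positive integers with $2k\le n$, and let $x\in\mathbb{R}^n$ have its coordinates ordered so that $|x_1|\ge|x_2|\ge\cdots\ge|x_n|$ and satisfy \[ |x_k|-|x_{2k}|\ge a\,\frac{\|x_{\overline{[k]}}\|_2}{\sqrt{k}}. \] Let $\widehat{x}$ be the Count-Sketch estimate of $x$ using $R\ge b\log n$ rows and $ck$ columns with fully random hash functions. Then with probability at least $1-K/k^d$, \[ E_k(x,\widehat{x})^2\le \frac{1}{R}\|x_{\overline{[k]}}\|_2^2 . \]
   Context: Count-Sketch with $R$ rows and $C$ columns: for each row $u\in[R]$ choose hash functions $h_u:[n]\to[C]$ and $s_u:[n]\to\{\pm1\}$; "fully random" means all values $h_u(i)$ (uniform on $[C]$) and $s_u(i)$ (uniform on $\{\pm1\}$) are mutually independent. The sketch is $y_{u,v}=\sum_{i:h_u(i)=v}s_u(i)x_i$ and the estimate is $\widehat{x}_i=\operatorname{median}_{u\in[R]} s_u(i)\,y_{u,h_u(i)}$ (average of the two middle values for even $R$). $x_{\overline{[k]}}$ denotes $x$ with its $k$ largest-magnitude coordinates (here $x_1,\dots,x_k$) replaced by $0$. For $z\in\mathbb{R}^n$, $H_k(z)$ is the restriction of $z$ to its $k$ largest-magnitude components (other coordinates set to $0$). The top-$k$ estimation error is $E_k(x,\widehat{x})=\min_{x'\in\mathbb{R}^n:\,H_k(x')=H_k(\widehat{x})}\|x-x'\|_2$. *)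

theory Defs
  imports "HOL-Probability.Probability"
begin

(* Vectors in R^n are functions nat => real; coordinates 0..n-1
   (paper's coordinate i corresponds to index i-1 here). *)

definition median :: "real list \<Rightarrow> real" where
  "median xs = (let ys = sort xs; m = length ys in
     if odd m then ys ! (m div 2)
     else (ys ! (m div 2 - 1) + ys ! (m div 2)) / 2)"

definition l2norm :: "nat \<Rightarrow> (nat \<Rightarrow> real) \<Rightarrow> real" where
  "l2norm n z = sqrt (\<Sum>i<n. (z i)^2)"

(* tail x_{bar [k]} assuming |x_0| >= |x_1| >= ... : zero out first k coordinates *)
definition tail_vec :: "nat \<Rightarrow> (nat \<Rightarrow> real) \<Rightarrow> nat \<Rightarrow> real" where
  "tail_vec k x = (\<lambda>i. if i < k then 0 else x i)"

definition topk :: "nat \<Rightarrow> nat \<Rightarrow> (nat \<Rightarrow> real) \<Rightarrow> nat set" where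
  "topk n k z = {i. i < n \<and>
      card {j. j < n \<and> (\<bar>z j\<bar> > \<bar>z i\<bar> \<or> (\<bar>z j\<bar> = \<bar>z i\<bar> \<and> j < i))} < k}"

definition Hk :: "nat \<Rightarrow> nat \<Rightarrow> (nat \<Rightarrow> real) \<Rightarrow> nat \<Rightarrow> real" where
  "Hk n k z = (\<lambda>i. if i \<in> topk n k z then z i else 0)"

definition Ek :: "nat \<Rightarrow> nat \<Rightarrow> (nat \<Rightarrow> real) \<Rightarrow> (nat \<Rightarrow> real) \<Rightarrow> real" where
  "Ek n k x xh = Inf {l2norm n (\<lambda>i. x i - x' i) | x'.
        (\<forall>i\<ge>n. x' i = 0) \<and> Hk n k x' = Hk n k xh}"

(* fully random hash functions for R rows, C columns, n coordinates:
   h u i uniform on {0..<C}, s u i uniform on {-1,1}, all independent;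
   values outside u<R, i<n fixed to a default so the space is finite *)
definition hash_space :: "nat \<Rightarrow> nat \<Rightarrow> nat \<Rightarrow>
    ((nat \<Rightarrow> nat \<Rightarrow> nat) \<times> (nat \<Rightarrow> nat \<Rightarrow> real)) set" where
  "hash_space R C n = {(h, s). \<forall>u i.
      (u < R \<and> i < n \<longrightarrow> h u i < C \<and> (s u i = 1 \<or> s u i = -1)) \<and>
      (\<not> (u < R \<and> i < n) \<longrightarrow> h u i = 0 \<and> s u i = 1)}"

definition hash_pmf :: "nat \<Rightarrow> nat \<Rightarrow> nat \<Rightarrow>
    ((nat \<Rightarrow> nat \<Rightarrow> nat) \<times> (nat \<Rightarrow> nat \<Rightarrow> real)) pmf" where
  "hash_pmf R C n = pmf_of_set (hash_space R C n)"

definition sketch :: "nat \<Rightarrow> (nat \<Rightarrow> nat \<Rightarrow> nat) \<Rightarrow> (nat \<Rightarrow> nat \<Rightarrow> real)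
    \<Rightarrow> (nat \<Rightarrow> real) \<Rightarrow> nat \<Rightarrow> nat \<Rightarrow> real" where
  "sketch n h s x u v = (\<Sum>i\<in>{i. i < n \<and> h u i = v}. s u i * x i)"

definition cs_estimate :: "nat \<Rightarrow> nat \<Rightarrow> (nat \<Rightarrow> nat \<Rightarrow> nat) \<Rightarrow> (nat \<Rightarrow> nat \<Rightarrow> real)
    \<Rightarrow> (nat \<Rightarrow> real) \<Rightarrow> nat \<Rightarrow> real" where
  "cs_estimate R n h s x i = (if i < n then
      median (map (\<lambda>u. s u i * sketch n h s x u (h u i)) [0..<R]) else 0)"

end

theory Submission
  imports Defs "HOL-Real_Asymp.Real_Asymp"
begin

text \<open>
  Write \<open>T\<close> for the norm of the tail, \<open>s = T / sqrt C\<close> and \<open>e\<^sub>u\<^sub>,\<^sub>i\<close> for the error of row \<open>u\<close> at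
  coordinate \<open>i\<close>. The noise in one bin is a weighted sum of independent lazy signs, hence a
  difference of two independent copies of one variable; a pigeonhole argument then gives
  \<open>Pr[|e\<^sub>u\<^sub>,\<^sub>i| \<le> t s] \<ge> t / 20\<close> for \<open>t \<le> 1\<close>, so that \<open>e\<^sub>u\<^sub>,\<^sub>i\<close> exceeds \<open>t s\<close> with probability at most
  \<open>1/2 - t/40\<close>. A Chernoff bound over the rows shows that the median errs by more than \<open>t s\<close> with
  probability \<open>exp (- \<Omega>(R t\<^sup>2))\<close>. The same bound holds jointly for any set \<open>J\<close> of \<open>O(log k)\<close>
  coordinates, with the exponents adding up: when the items of \<open>J\<close> land in distinct bins of a row,
  the bins can be exposed one after the other, and the rows where they collide are rare and unbiased.
  Consequently the moments of order \<open>log k\<close> of the sum of the squared errors of the first \<open>2 k\<close>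
  coordinates behave as if these errors were independent, and Markov's inequality yields a failure
  probability polynomially small in \<open>k\<close>. Finally the gap \<open>|x\<^sub>k| - |x\<^sub>2\<^sub>k|\<close> exceeds twice the
  maximal error, so the top \<open>k\<close> estimates lie among the first \<open>2 k\<close> coordinates and only those
  errors matter.
\<close>

section \<open>Expectations over finite product distributions\<close>

abbreviation E :: "'a pmf \<Rightarrow> ('a \<Rightarrow> real) \<Rightarrow> real" where
  "E p f \<equiv> measure_pmf.expectation p f"

lemma finite_set_Pi_pmf:
  assumes "finite A" "\<And>x. x \<in> A \<Longrightarrow> finite (set_pmf (p x))"
  shows "finite (set_pmf (Pi_pmf A d p))"
  using assms by (auto simp: set_Pi_pmf intro: finite_PiE_dflt)

lemma E_finite_mono:
  assumes "finite (set_pmf p)" "\<And>x. x \<in> set_pmf p \<Longrightarrow> f x \<le> g x"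
  shows "E p f \<le> E p g"
  using assms by (intro integral_mono_AE integrable_measure_pmf_finite) (auto simp: AE_measure_pmf_iff)

lemma E_cong:
  assumes "\<And>x. x \<in> set_pmf p \<Longrightarrow> f x = g x"
  shows "E p f = E p g"
  using assms by (intro integral_cong_AE) (auto simp: AE_measure_pmf_iff)

lemma E_finite_add:
  assumes "finite (set_pmf p)"
  shows "E p (\<lambda>x. f x + g x) = E p f + E p g"
  using assms by (intro Bochner_Integration.integral_add integrable_measure_pmf_finite)

lemma E_finite_diff:
  assumes "finite (set_pmf p)"
  shows "E p (\<lambda>x. f x - g x) = E p f - E p g"
  using assms by (intro Bochner_Integration.integral_diff integrable_measure_pmf_finite)

lemma E_finite_sum:
  assumes "finite (set_pmf p)"
  shows "E p (\<lambda>x. \<Sum>i\<in>I. f i x) = (\<Sum>i\<in>I. E p (f i))"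
  using assms by (intro Bochner_Integration.integral_sum integrable_measure_pmf_finite)

lemma E_bind:
  assumes "finite (set_pmf p)" "\<And>x. x \<in> set_pmf p \<Longrightarrow> finite (set_pmf (f x))"
  shows "E (bind_pmf p f) h = E p (\<lambda>x. E (f x) h)"
proof -
  have "E p g = (\<Sum>a\<in>set_pmf p. pmf p a * g a)" for g
    using assms by (subst integral_measure_pmf[of "set_pmf p"]) auto
  then show ?thesis using assms by (subst pmf_expectation_bind[of "set_pmf p"]) simp_all
qed

lemma E_swap:
  assumes "finite (set_pmf p)" "finite (set_pmf q)"
  shows "E p (\<lambda>x. E q (\<lambda>y. f x y)) = E q (\<lambda>y. E p (\<lambda>x. f x y))"
proof -
  have p: "E p g = (\<Sum>a\<in>set_pmf p. pmf p a * g a)" for g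
    using assms by (subst integral_measure_pmf[of "set_pmf p"]) auto
  have q: "E q g = (\<Sum>a\<in>set_pmf q. pmf q a * g a)" for g
    using assms by (subst integral_measure_pmf[of "set_pmf q"]) auto
  show ?thesis unfolding p q
    by (simp add: sum_distrib_left) (subst sum.swap, simp add: mult_ac)
qed

lemma E_pair:
  assumes "finite (set_pmf p)" "finite (set_pmf q)"
  shows "E (pair_pmf p q) f = E p (\<lambda>x. E q (\<lambda>y. f (x, y)))"
  using assms by (simp add: pair_pmf_def E_bind)

lemma E_Pi_insert:
  assumes "finite A" "x \<notin> A" "\<And>y. y \<in> insert x A \<Longrightarrow> finite (set_pmf (p y))"
  shows "E (Pi_pmf (insert x A) d p) F = E (p x) (\<lambda>y. E (Pi_pmf A d p) (\<lambda>f. F (f(x := y))))"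
  using assms by (simp add: Pi_pmf_insert E_pair finite_set_Pi_pmf case_prod_beta)

lemma E_Pi_union:
  assumes "finite A" "finite B" "A \<inter> B = {}" "\<And>y. y \<in> A \<union> B \<Longrightarrow> finite (set_pmf (p y))"
  shows "E (Pi_pmf (A \<union> B) d p) F =
    E (Pi_pmf A d p) (\<lambda>f. E (Pi_pmf B d p) (\<lambda>g. F (\<lambda>x. if x \<in> A then f x else g x)))"
  using assms by (simp add: Pi_pmf_union E_pair finite_set_Pi_pmf case_prod_beta fst_conv snd_conv cong: if_cong)

lemma prob_le_E:
  assumes "finite (set_pmf p)" "\<And>x. x \<in> set_pmf p \<Longrightarrow> f x \<ge> 0"
    and "\<And>x. x \<in> set_pmf p \<Longrightarrow> x \<in> A \<Longrightarrow> f x \<ge> 1"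
  shows "measure_pmf.prob p A \<le> E p f"
proof -
  have "measure_pmf.prob p A = E p (indicator A)" by simp
  also have "\<dots> \<le> E p f"
    using assms by (intro E_finite_mono) (auto simp: indicator_def)
  finally show ?thesis .
qed

section \<open>A small ball estimate\<close>

text \<open>The contribution of one item to a fixed bin: absent with probability
  \<open>1 - p\<close>, otherwise a uniform sign.\<close>

definition lazy_sign :: "real \<Rightarrow> real pmf" where
  "lazy_sign p = bind_pmf (bernoulli_pmf p) (\<lambda>b. if b then pmf_of_set {1, -1} else return_pmf 0)"

lemma finite_set_lazy_sign [simp]: "finite (set_pmf (lazy_sign p))"
  by (auto simp: lazy_sign_def)

lemma E_lazy_sign:
  assumes "0 \<le> p" "p \<le> 1"
  shows "E (lazy_sign p) f = p * (f 1 + f (-1)) / 2 + (1 - p) * f 0"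
  using assms by (simp add: lazy_sign_def E_bind integral_pmf_of_set)

text \<open>A lazy sign is a difference of two independent Bernoulli variables, so a weighted sum of lazy
  signs is a difference of two independent copies of one variable.\<close>
lemma E_lazy_sum_eq_diff:
  fixes x :: "'a \<Rightarrow> real"
  assumes "finite M" "0 \<le> \<alpha>" "\<alpha> \<le> 1"
  defines "L \<equiv> \<lambda>M. Pi_pmf M False (\<lambda>_. bernoulli_pmf \<alpha>)"
  shows "E (Pi_pmf M 0 (\<lambda>_. lazy_sign (2 * \<alpha> * (1 - \<alpha>)))) (\<lambda>w. F (\<Sum>j\<in>M. w j * x j)) =
    E (L M) (\<lambda>a. E (L M) (\<lambda>b. F ((\<Sum>j\<in>M. of_bool (a j) * x j) - (\<Sum>j\<in>M. of_bool (b j) * x j))))"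
  using assms(1)
proof (induction M arbitrary: F rule: finite_induct)
  case empty
  then show ?case by (simp add: L_def)
next
  case (insert i M)
  define p where "p = 2 * \<alpha> * (1 - \<alpha>)"
  have p: "0 \<le> p" "p \<le> 1"
  proof -
    show "0 \<le> p" using assms by (simp add: p_def)
    have "2 * p = 1 - (1 - 2 * \<alpha>)\<^sup>2" by (simp add: p_def power2_eq_square algebra_simps)
    then show "p \<le> 1" using zero_le_power2[of "1 - 2 * \<alpha>"] by linarith
  qed
  have fin: "finite (set_pmf (L M))" using insert by (auto simp: L_def intro!: finite_set_Pi_pmf)
  have upd: "(\<Sum>j\<in>M. (f(i := y)) j * x j) = (\<Sum>j\<in>M. f j * x j)" for f :: "'a \<Rightarrow> real" and y
    using insert by (intro sum.cong) auto
  let ?S = "\<lambda>a. (\<Sum>j\<in>M. of_bool (a j) * x j)"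
  have ins_sum: "(\<Sum>j\<in>insert i M. of_bool ((f(i := y)) j) * x j) = of_bool y * x i + ?S f" for f y
  proof -
    have "(\<Sum>j\<in>M. of_bool ((f(i := y)) j) * x j) = ?S f"
      using insert.hyps by (intro sum.cong) auto
    then show ?thesis by (simp only: sum.insert[OF insert.hyps] fun_upd_same)
  qed
  have alg: "(of_bool y - of_bool y') * x i + (?S a - ?S b) =
    (of_bool y * x i + ?S a) - (of_bool y' * x i + ?S b)" for y y' a b
    by (simp add: algebra_simps)
  have insL: "E (L (insert i M)) G = E (bernoulli_pmf \<alpha>) (\<lambda>y. E (L M) (\<lambda>f. G (f(i := y))))" for G
    unfolding L_def using insert by (subst E_Pi_insert) auto
  have "E (Pi_pmf (insert i M) 0 (\<lambda>_. lazy_sign p)) (\<lambda>w. F (\<Sum>j\<in>insert i M. w j * x j)) =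
      E (lazy_sign p) (\<lambda>y. E (Pi_pmf M 0 (\<lambda>_. lazy_sign p)) (\<lambda>w. F (y * x i + (\<Sum>j\<in>M. w j * x j))))"
    using insert by (subst E_Pi_insert) (auto simp: upd simp del: fun_upd_apply, simp)
  also have "\<dots> = E (lazy_sign p) (\<lambda>y. E (L M) (\<lambda>a. E (L M) (\<lambda>b. F (y * x i + (?S a - ?S b)))))"
    using insert.IH[of "\<lambda>z. F (_ * x i + z)"] by (simp add: p_def)
  \<comment> \<open>The difference of two independent Bernoulli variables takes each of the values 1
    and -1 with probability \<open>\<alpha> * (1 - \<alpha>) = p / 2\<close>.\<close>
  also have "\<dots> = E (bernoulli_pmf \<alpha>) (\<lambda>y. E (bernoulli_pmf \<alpha>) (\<lambda>y'. 
      E (L M) (\<lambda>a. E (L M) (\<lambda>b. F ((of_bool y - of_bool y') * x i + (?S a - ?S b))))))"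
    using assms p by (subst E_lazy_sign) (auto simp: p_def field_simps)
  \<comment> \<open>\<open>y'\<close> moves inside the expectation over \<open>a\<close>, so that it
    joins \<open>b\<close> as the new coordinate of the second copy.\<close>
  also have "\<dots> = E (bernoulli_pmf \<alpha>) (\<lambda>y. E (L M) (\<lambda>a. E (bernoulli_pmf \<alpha>) (\<lambda>y'. 
      E (L M) (\<lambda>b. F ((of_bool y - of_bool y') * x i + (?S a - ?S b))))))"
    by (subst E_swap[OF _ fin]) auto
  also have "\<dots> = E (L (insert i M)) (\<lambda>a. E (L (insert i M)) (\<lambda>b. F ((\<Sum>j\<in>insert i M. of_bool (a j) * x j) - (\<Sum>j\<in>insert i M. of_bool (b j) * x j))))"
    by (simp only: insL ins_sum alg)
  finally show ?case by (simp add: p_def)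
qed

lemma bernoulli_sum_variance:
  fixes x :: "'a \<Rightarrow> real"
  assumes "finite M" "0 \<le> \<alpha>" "\<alpha> \<le> 1"
  shows "E (Pi_pmf M False (\<lambda>_. bernoulli_pmf \<alpha>)) (\<lambda>b. (\<Sum>j\<in>M. (of_bool (b j) - \<alpha>) * x j)\<^sup>2)
      = \<alpha> * (1 - \<alpha>) * (\<Sum>j\<in>M. (x j)\<^sup>2)"
proof -
  let ?L = "\<lambda>M. Pi_pmf M False (\<lambda>_. bernoulli_pmf \<alpha>)"
  let ?S = "\<lambda>M b. \<Sum>j\<in>M. (of_bool (b j) - \<alpha>) * x j"
  \<comment> \<open>The mean is carried through the induction because it annihilates the cross term
    of the square.\<close>
  have "E (?L M) (?S M) = 0 \<and> E (?L M) (\<lambda>b. (?S M b)\<^sup>2) = \<alpha> * (1 - \<alpha>) * (\<Sum>j\<in>M. (x j)\<^sup>2)"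
    using assms(1)
  proof (induction M rule: finite_induct)
    case (insert i M)
    have fin: "finite (set_pmf (?L M))" using insert by (auto intro!: finite_set_Pi_pmf)
    note int = integrable_measure_pmf_finite[OF fin]
    have upd: "?S M (f(i := y)) = ?S M f" for f y
      using insert by (intro sum.cong) auto
    have "E (?L (insert i M)) (?S (insert i M)) = E (bernoulli_pmf \<alpha>) (\<lambda>y. (of_bool y - \<alpha>) * x i + E (?L M) (?S M))"
      using insert by (subst E_Pi_insert) (auto simp: upd int simp del: fun_upd_apply, simp add: int)
    also have "\<dots> = 0" using insert assms by (simp add: algebra_simps)
    finally have 1: "E (?L (insert i M)) (?S (insert i M)) = 0" .
    have "E (?L (insert i M)) (\<lambda>b. (?S (insert i M) b)\<^sup>2) =
      E (bernoulli_pmf \<alpha>) (\<lambda>y. E (?L M) (\<lambda>b. ((of_bool y - \<alpha>) * x i + ?S M b)\<^sup>2))"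
      using insert by (subst E_Pi_insert) (auto simp: upd int simp del: fun_upd_apply, simp add: int)
    also have "\<dots> = E (bernoulli_pmf \<alpha>) (\<lambda>y. ((of_bool y - \<alpha>) * x i)\<^sup>2 + E (?L M) (\<lambda>b. (?S M b)\<^sup>2))"
    proof (intro E_cong)
      fix y
      have "E (?L M) (\<lambda>b. ((of_bool y - \<alpha>) * x i + ?S M b)\<^sup>2) =
        E (?L M) (\<lambda>b. ((of_bool y - \<alpha>) * x i)\<^sup>2 + (2 * ((of_bool y - \<alpha>) * x i) * ?S M b + (?S M b)\<^sup>2))"
        by (simp only: power2_sum add_ac)
      also have "\<dots> = ((of_bool y - \<alpha>) * x i)\<^sup>2 + (2 * ((of_bool y - \<alpha>) * x i) * E (?L M) (?S M) + E (?L M) (\<lambda>b. (?S M b)\<^sup>2))"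
        by (simp only: E_finite_add[OF fin]) (simp del: of_bool_eq)
      finally show "E (?L M) (\<lambda>b. ((of_bool y - \<alpha>) * x i + ?S M b)\<^sup>2) = ((of_bool y - \<alpha>) * x i)\<^sup>2 + E (?L M) (\<lambda>b. (?S M b)\<^sup>2)"
        using insert by simp
    qed
    also have "\<dots> = \<alpha> * (1 - \<alpha>) * (\<Sum>j\<in>insert i M. (x j)\<^sup>2)"
      using insert assms by (simp add: power2_eq_square algebra_simps)
    finally show ?case using 1 by simp
  qed simp
  then show ?thesis by simp
qed

text \<open>The sum is a difference of two independent copies of one variable. Avoiding the items of
  \<open>H\<close> and applying Chebyshev to the others puts at least half of its law in an interval
  of length \<open>4 * s\<close>. Cut this into at most \<open>5 / t\<close> cells of length
  \<open>t * s\<close>: by Cauchy-Schwarz the two copies share a cell with probability at least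
  (1/4) * (t/5).\<close>

lemma small_ball:
  fixes x :: "'a \<Rightarrow> real" and p s t :: real
  assumes M: "finite M" and p: "0 \<le> p" "p \<le> 1/2"
    and H: "finite H" "p * card H \<le> 1/4"
    and var: "p / 2 * (\<Sum>j\<in>M - H. (x j)\<^sup>2) \<le> s\<^sup>2" and s: "s \<ge> 0" and t: "0 \<le> t" "t \<le> 1"
  shows "t / 20 \<le> E (Pi_pmf M 0 (\<lambda>_. lazy_sign p)) (\<lambda>w. of_bool (\<bar>\<Sum>j\<in>M. w j * x j\<bar> \<le> t * s))"
proof (cases "t = 0")
  case True
  then show ?thesis by simp
next
  case False
  with t have t0: "t > 0" by simp
  \<comment> \<open>The smaller root of \<open>2 * \<alpha> * (1 - \<alpha>) = p\<close>, real
    because \<open>p \<le> 1/2\<close>.\<close>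
  define \<alpha> where "\<alpha> = (1 - sqrt (1 - 2 * p)) / 2"
  have \<alpha>: "0 \<le> \<alpha>" "\<alpha> \<le> 1/2" "2 * \<alpha> * (1 - \<alpha>) = p"
    using p by (auto simp: \<alpha>_def field_simps)
  have \<alpha>p: "\<alpha> \<le> p"
  proof -
    have "\<alpha> * (1/2) \<le> \<alpha> * (1 - \<alpha>)" using \<alpha> by (intro mult_left_mono) auto
    then show ?thesis using \<alpha>(3) by simp
  qed
  define L where "L = Pi_pmf M False (\<lambda>_. bernoulli_pmf \<alpha>)"
  have finL: "finite (set_pmf L)" unfolding L_def using M by (auto intro!: finite_set_Pi_pmf)
  define A where "A = (\<lambda>a. \<Sum>j\<in>M. of_bool (a j) * x j)"
  define \<mu> where "\<mu> = (\<Sum>j\<in>M - H. \<alpha> * x j)"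
  \<comment> \<open>Zeroing the weights on \<open>H\<close> lets the variance formula be used over
    all of \<open>M\<close>.\<close>
  define x' where "x' = (\<lambda>j. if j \<in> H then 0 else x j)"
  define D where "D = (\<lambda>b. \<Sum>j\<in>M. (of_bool (b j) - \<alpha>) * x' j)"
  have varD: "E L (\<lambda>b. (D b)\<^sup>2) \<le> s\<^sup>2"
  proof -
    have "(\<Sum>j\<in>M. (x' j)\<^sup>2) = (\<Sum>j\<in>M - H. (x j)\<^sup>2)"
      using M by (intro sum.mono_neutral_cong_right) (auto simp: x'_def)
    then have "E L (\<lambda>b. (D b)\<^sup>2) = p / 2 * (\<Sum>j\<in>M - H. (x j)\<^sup>2)"
      unfolding L_def D_def using M \<alpha> by (subst bernoulli_sum_variance) auto
    then show ?thesis using var by simp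
  qed
  have far: "E L (\<lambda>b. of_bool (\<bar>D b\<bar> > 2 * s)) \<le> 1/4"
  proof (cases "s = 0")
    case True
    \<comment> \<open>Chebyshev would divide by zero here; instead the vanishing variance makes
      \<open>D\<close> zero almost surely.\<close>
    have "E L (\<lambda>b. (D b)\<^sup>2) = 0" using varD True by (simp add: antisym)
    then have "AE b in L. (D b)\<^sup>2 = 0"
      by (subst (asm) integral_nonneg_eq_0_iff_AE) (auto intro: integrable_measure_pmf_finite finL)
    then have "E L (\<lambda>b. of_bool (\<bar>D b\<bar> > 2 * s)) = E L (\<lambda>b. 0)"
      using True by (intro E_cong) (auto simp: AE_measure_pmf_iff)
    then show ?thesis by simp
  next
    case False
    then have "s > 0" using s by simp
    have "E L (\<lambda>b. of_bool (\<bar>D b\<bar> > 2 * s)) \<le> E L (\<lambda>b. (1 / (4 * s\<^sup>2)) * (D b)\<^sup>2)"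
    proof (intro E_finite_mono finL)
      fix b
      show "of_bool (\<bar>D b\<bar> > 2 * s) \<le> 1 / (4 * s\<^sup>2) * (D b)\<^sup>2"
      proof (cases "\<bar>D b\<bar> > 2 * s")
        case True
        have "(2 * s)\<^sup>2 \<le> \<bar>D b\<bar>\<^sup>2" using True \<open>s > 0\<close> by (intro power_mono) auto
        then show ?thesis using True \<open>s > 0\<close> by (simp add: field_simps)
      qed auto
    qed
    also have "\<dots> \<le> 1 / (4 * s\<^sup>2) * s\<^sup>2"
      using varD by (simp add: divide_right_mono)
    also have "\<dots> \<le> 1/4" using \<open>s > 0\<close> by simp
    finally show ?thesis .
  qed
  \<comment> \<open>Union bound: each item of \<open>H\<close> is active with probability \<alpha>
    \<le> p, and \<open>p * card H \<le> 1/4\<close>.\<close>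
  have heavy: "E L (\<lambda>b. of_bool (\<exists>j\<in>M \<inter> H. b j)) \<le> 1/4"
  proof -
    have "E L (\<lambda>b. of_bool (\<exists>j\<in>M \<inter> H. b j)) \<le> E L (\<lambda>b. \<Sum>j\<in>M \<inter> H. of_bool (b j))"
    proof (intro E_finite_mono finL)
      fix b
      show "of_bool (\<exists>j\<in>M \<inter> H. b j) \<le> (\<Sum>j\<in>M \<inter> H. of_bool (b j) :: real)"
      proof (cases "\<exists>j\<in>M \<inter> H. b j")
        case True
        then obtain j where j: "j \<in> M \<inter> H" "b j" by blast
        have "of_bool (b j) \<le> (\<Sum>j\<in>M \<inter> H. of_bool (b j) :: real)"
          using M j by (intro member_le_sum) auto
        then show ?thesis using True j by simp
      qed (auto intro: sum_nonneg)
    qed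
    also have "\<dots> = (\<Sum>j\<in>M \<inter> H. E L (\<lambda>b. of_bool (b j)))" by (rule E_finite_sum[OF finL])
    also have "\<dots> = (\<Sum>j\<in>M \<inter> H. \<alpha>)"
    proof (intro sum.cong refl)
      fix j assume "j \<in> M \<inter> H"
      then have "map_pmf (\<lambda>b. b j) L = bernoulli_pmf \<alpha>"
        unfolding L_def using M by (simp add: Pi_pmf_component)
      then have "E L (\<lambda>b. of_bool (b j)) = E (bernoulli_pmf \<alpha>) of_bool"
        by (metis (no_types, lifting) integral_map_pmf Bochner_Integration.integral_cong)
      then show "E L (\<lambda>b. of_bool (b j)) = \<alpha>" using \<alpha> by simp
    qed
    also have "\<dots> \<le> card H * p"
      using M H \<alpha>p p \<alpha> by (auto intro!: mult_mono card_mono)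
    finally show ?thesis using H by (simp add: mult.commute)
  qed
  define G where "G = (\<lambda>a. \<bar>A a - \<mu>\<bar> \<le> 2 * s)"
  have G: "E L (\<lambda>b. of_bool (G b)) \<ge> 1/2"
  proof -
    have "1 - of_bool (\<bar>D b\<bar> > 2 * s) - of_bool (\<exists>j\<in>M \<inter> H. b j) \<le> (of_bool (G b) :: real)" for b
    proof (cases "\<exists>j\<in>M \<inter> H. b j")
      case False
      have "A b - \<mu> = D b"
      proof -
        have "A b = (\<Sum>j\<in>M - H. of_bool (b j) * x j)"
          unfolding A_def using M False by (intro sum.mono_neutral_right) auto
        moreover have "D b = (\<Sum>j\<in>M - H. (of_bool (b j) - \<alpha>) * x j)"
          unfolding D_def using M by (intro sum.mono_neutral_cong_right) (auto simp: x'_def)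
        ultimately show ?thesis by (simp add: \<mu>_def sum_subtractf left_diff_distrib)
      qed
      then show ?thesis by (auto simp: G_def)
    qed auto
    then have "E L (\<lambda>b. 1 - of_bool (\<bar>D b\<bar> > 2 * s) - of_bool (\<exists>j\<in>M \<inter> H. b j)) \<le> E L (\<lambda>b. of_bool (G b))"
      by (intro E_finite_mono finL)
    then show ?thesis using far heavy by (simp only: E_finite_diff[OF finL]) simp
  qed
  \<comment> \<open>for \<open>s = 0\<close> the division by zero puts everything into interval \<open>0\<close>, as it should\<close>
  define idx where "idx = (\<lambda>a. nat \<lfloor>(A a - \<mu> + 2 * s) / (t * s)\<rfloor>)"
  define I where "I = {..nat \<lfloor>4 / t\<rfloor>}"
  define q where "q = (\<lambda>r a. of_bool (G a \<and> idx a = r) :: real)"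
  have idx: "idx a \<in> I" if "G a" for a
  proof -
    have "(A a - \<mu> + 2 * s) / (t * s) \<le> 4 / t"
    proof (cases "s = 0")
      case False
      then have "(A a - \<mu> + 2 * s) / (t * s) \<le> (4 * s) / (t * s)"
        using that t0 s by (intro divide_right_mono) (auto simp: G_def abs_le_iff)
      then show ?thesis using False by simp
    qed (use t0 in auto)
    then show ?thesis unfolding idx_def I_def by (auto intro!: nat_mono floor_mono)
  qed
  have close: "\<bar>A a - A b\<bar> \<le> t * s" if "G a" "G b" "idx a = idx b" for a b
  proof (cases "s = 0")
    case True
    then show ?thesis using that by (simp add: G_def)
  next
    case False
    define u v where "u = (A a - \<mu> + 2 * s) / (t * s)" and "v = (A b - \<mu> + 2 * s) / (t * s)"
    have ts: "t * s > 0" using False t0 s by simp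
    have "u \<ge> 0" "v \<ge> 0" using that ts by (auto simp: u_def v_def G_def abs_le_iff)
    moreover have "nat \<lfloor>u\<rfloor> = nat \<lfloor>v\<rfloor>" using that by (simp add: idx_def u_def v_def)
    ultimately have "\<lfloor>u\<rfloor> = \<lfloor>v\<rfloor>" by (simp add: nat_eq_iff2)
    then have "\<bar>u - v\<bar> \<le> 1" by linarith
    moreover have "A a - A b = (u - v) * (t * s)"
      using False t0 unfolding u_def v_def diff_divide_distrib[symmetric] by simp
    ultimately have "\<bar>A a - A b\<bar> = \<bar>u - v\<bar> * (t * s)" using ts by (simp only: abs_mult[of "u - v"] abs_of_pos)
    also have "\<dots> \<le> 1 * (t * s)" using \<open>\<bar>u - v\<bar> \<le> 1\<close> ts by (intro mult_right_mono) auto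
    finally show ?thesis by simp
  qed
  have "1/2 \<le> E L (\<lambda>b. of_bool (G b))" by (rule G)
  also have "\<dots> = E L (\<lambda>b. \<Sum>r\<in>I. q r b)"
  proof (intro E_cong)
    fix b
    have "(\<Sum>r\<in>I. q r b) = (\<Sum>r\<in>I. if r = idx b then of_bool (G b) else 0)"
      by (intro sum.cong) (auto simp: q_def)
    also have "\<dots> = of_bool (G b)" using idx[of b] by (auto simp: I_def)
    finally show "of_bool (G b) = (\<Sum>r\<in>I. q r b)" by simp
  qed
  also have "\<dots> = (\<Sum>r\<in>I. E L (q r))" by (rule E_finite_sum[OF finL])
  finally have "(1/2)\<^sup>2 \<le> (\<Sum>r\<in>I. E L (q r))\<^sup>2" by (intro power_mono) auto
  \<comment> \<open>Cauchy-Schwarz over the cells. The sum of the squared cell masses is the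
    probability that both copies are good and lie in the same cell.\<close>
  also have "\<dots> \<le> (\<Sum>r\<in>I. (E L (q r))\<^sup>2) * card I" by (rule sum_squared_le_sum_of_squares)
  also have "(\<Sum>r\<in>I. (E L (q r))\<^sup>2) = E L (\<lambda>a. E L (\<lambda>b. \<Sum>r\<in>I. q r a * q r b))"
    by (simp add: E_finite_sum[OF finL] power2_eq_square)
  also have "\<dots> * card I \<le> E L (\<lambda>a. E L (\<lambda>b. of_bool (\<bar>A a - A b\<bar> \<le> t * s))) * card I"
  proof (intro mult_right_mono E_finite_mono finL)
    fix a b
    have "(\<Sum>r\<in>I. q r a * q r b) = (\<Sum>r\<in>I. if r = idx a then of_bool (G a) * q (idx a) b else 0)"
      by (intro sum.cong) (auto simp: q_def)
    also have "\<dots> \<le> of_bool (G a) * q (idx a) b" by (auto simp: I_def q_def)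
    also have "\<dots> \<le> of_bool (\<bar>A a - A b\<bar> \<le> t * s)" using close[of a b] by (auto simp: q_def)
    finally show "(\<Sum>r\<in>I. q r a * q r b) \<le> of_bool (\<bar>A a - A b\<bar> \<le> t * s)" .
  qed auto
  also have "E L (\<lambda>a. E L (\<lambda>b. of_bool (\<bar>A a - A b\<bar> \<le> t * s))) =
      E (Pi_pmf M 0 (\<lambda>_. lazy_sign p)) (\<lambda>w. of_bool (\<bar>\<Sum>j\<in>M. w j * x j\<bar> \<le> t * s))"
    using E_lazy_sum_eq_diff[OF M, of \<alpha> "\<lambda>z. of_bool (\<bar>z\<bar> \<le> t * s)" x] \<alpha> by (simp add: A_def L_def)
  also have "\<dots> * card I \<le> \<dots> * (5 / t)"
  proof (intro mult_left_mono)
    \<comment> \<open>The cell of index 0 adds one to the count; it is absorbed by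
      \<open>1 \<le> 1 / t\<close>.\<close>
    have "real (card I) = real (nat \<lfloor>4 / t\<rfloor>) + 1" by (simp add: I_def)
    also have "\<dots> \<le> 4 / t + 1" using t0 by simp
    also have "\<dots> \<le> 5 / t" using t0 t by (simp add: field_simps)
    finally show "real (card I) \<le> 5 / t" .
  qed auto
  finally show ?thesis using t0 by (simp add: field_simps power2_eq_square)
qed

text \<open>Negating all weights preserves the law, so the mass outside the small ball splits evenly
  between both sides. Small-ball mass thus becomes a negative drift of the exceedance sign.\<close>

lemma lazy_sum_one_sided:
  fixes x :: "'a \<Rightarrow> real"
  assumes M: "finite M" and p: "0 \<le> p" "p \<le> 1" and sg: "\<sigma> = 1 \<or> \<sigma> = -1" and \<tau>: "\<tau> \<ge> 0"
  defines "W \<equiv> Pi_pmf M 0 (\<lambda>_. lazy_sign p)"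
  shows "E W (\<lambda>w. if \<sigma> * (\<Sum>j\<in>M. w j * x j) > \<tau> then 1 else -1)
    = - E W (\<lambda>w. of_bool (\<bar>\<Sum>j\<in>M. w j * x j\<bar> \<le> \<tau>))"
proof -
  let ?S = "\<lambda>w. \<Sum>j\<in>M. w j * x j"
  have fin: "finite (set_pmf W)" unfolding W_def using M by (auto intro!: finite_set_Pi_pmf)
  have "map_pmf uminus (lazy_sign p) = lazy_sign p"
    unfolding lazy_sign_def map_bind_pmf
    by (intro bind_pmf_cong refl) (auto simp: map_pmf_of_set_inj insert_commute)
  then have "W = map_pmf (\<lambda>h. uminus \<circ> h) W"
    unfolding W_def using Pi_pmf_map[OF M, of uminus "0::real" 0 "\<lambda>_. lazy_sign p"] by simp
  then have sym: "E W F = E W (\<lambda>w. F (uminus \<circ> w))" for F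
    by (metis integral_map_pmf)
  have flip: "?S (uminus \<circ> w) = - ?S w" for w by (simp add: sum_negf)
  have eq: "E W (\<lambda>w. of_bool (?S w > \<tau>)) = E W (\<lambda>w. of_bool (- ?S w > \<tau>))"
    by (subst sym) (simp only: flip)
  have "E W (\<lambda>w. of_bool (\<bar>?S w\<bar> \<le> \<tau>)) = E W (\<lambda>w. 1 - of_bool (?S w > \<tau>) - of_bool (- ?S w > \<tau>))"
    using \<tau> by (intro E_cong) auto
  also have "\<dots> = 1 - 2 * E W (\<lambda>w. of_bool (?S w > \<tau>))"
    by (simp only: E_finite_diff[OF fin] eq) simp
  also have "E W (\<lambda>w. of_bool (?S w > \<tau>)) = E W (\<lambda>w. of_bool (\<sigma> * ?S w > \<tau>))"
    using sg eq by auto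
  finally have *: "E W (\<lambda>w. of_bool (\<bar>?S w\<bar> \<le> \<tau>)) = 1 - 2 * E W (\<lambda>w. of_bool (\<sigma> * ?S w > \<tau>))" .
  have "E W (\<lambda>w. if \<sigma> * ?S w > \<tau> then 1 else -1) = E W (\<lambda>w. (of_bool (\<sigma> * ?S w > \<tau>) + of_bool (\<sigma> * ?S w > \<tau>)) - 1)"
    by (intro E_cong) auto
  also have "\<dots> = 2 * E W (\<lambda>w. of_bool (\<sigma> * ?S w > \<tau>)) - 1"
    by (simp only: E_finite_diff[OF fin] E_finite_add[OF fin]) simp
  finally show ?thesis using * by simp
qed

section \<open>Independence of distinct bins\<close>

text \<open>First decide whether the item falls into \<open>v\<close>, the nonzero value of the lazy
  sign being its sign; otherwise its bin is uniform over \<open>V\<close>.\<close>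

lemma uniform_bin_peel:
  assumes "finite V" "v \<notin> V" "V \<noteq> {}"
  shows "pmf_of_set (insert v V \<times> {1, -1 :: real}) =
    bind_pmf (lazy_sign (1 / real (card (insert v V))))
      (\<lambda>w. if w = 0 then pmf_of_set (V \<times> {1, -1}) else return_pmf (v, w))"
proof (rule pmf_eqI)
  fix a :: "'a \<times> real"
  obtain i s where a: "a = (i, s)" by (cases a)
  have card: "real (card (insert v V)) = real (card V) + 1" using assms by simp
  have V: "card V > 0" using assms by (simp add: card_gt_0_iff)
  have p: "0 \<le> 1 / (real (card V) + 1)" "1 / (real (card V) + 1) \<le> 1" by auto
  define U where "U = (\<lambda>A. pmf_of_set (A \<times> {1, -1 :: real}) :: ('a \<times> real) pmf)"
  have pmfs: "pmf (U A) (i, s) = of_bool (i \<in> A \<and> (s = 1 \<or> s = -1)) / (2 * real (card A))"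
    if "finite A" "A \<noteq> {}" for A :: "'a set"
    using that unfolding U_def by (subst pmf_of_set) (auto simp: card_cartesian_product indicator_def)
  have "pmf (U (insert v V)) (i, s) =
    pmf (bind_pmf (lazy_sign (1 / real (card (insert v V)))) (\<lambda>w. if w = 0 then U V else return_pmf (v, w))) (i, s)"
    using assms p V unfolding pmf_bind card
    by (subst E_lazy_sign) (auto simp: pmfs card divide_simps indicator_def simp del: card_insert_disjoint)
  then show "pmf (pmf_of_set (insert v V \<times> {1, -1 :: real})) a =
    pmf (bind_pmf (lazy_sign (1 / real (card (insert v V))))
      (\<lambda>w. if w = 0 then pmf_of_set (V \<times> {1, -1}) else return_pmf (v, w))) a"
    by (simp only: U_def a)
qed

text \<open>Expose the bins one at a time: given which items fall into one bin, the remaining items are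
  uniform over the remaining bins, so the one-bin bound applies again to a subset of the items.\<close>
lemma E_distinct_bins:
  fixes f :: "'i \<Rightarrow> real \<Rightarrow> real" and x :: "'a \<Rightarrow> real" and V :: "'c set"
  assumes "finite J" "finite M" "finite V" "inj_on v J" "v ` J \<subseteq> V" "card J < card V"
    and "\<And>i z. i \<in> J \<Longrightarrow> 0 \<le> f i z"
    and "\<And>i M' m. i \<in> J \<Longrightarrow> M' \<subseteq> M \<Longrightarrow> card V - card J < m \<Longrightarrow> m \<le> card V \<Longrightarrow>
      E (Pi_pmf M' 0 (\<lambda>_. lazy_sign (1 / real m))) (\<lambda>w. f i (\<Sum>j\<in>M'. w j * x j)) \<le> c i"
  shows "E (Pi_pmf M d (\<lambda>_. pmf_of_set (V \<times> {1, -1})))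
      (\<lambda>g. \<Prod>i\<in>J. f i (\<Sum>j\<in>{j\<in>M. fst (g j) = v i}. snd (g j) * x j)) \<le> (\<Prod>i\<in>J. c i)"
  using assms
proof (induction J arbitrary: M V rule: finite_induct)
  case (insert i J)
  define V' where "V' = V - {v i}"
  define p where "p = 1 / real (card V)"
  define W where "W = Pi_pmf M 0 (\<lambda>_. lazy_sign p)"
  define U where "U = (\<lambda>V. pmf_of_set (V \<times> {1, -1 :: real}) :: ('c \<times> real) pmf)"
  define N :: "'a set \<Rightarrow> ('a \<Rightarrow> 'c \<times> real) \<Rightarrow> 'c \<Rightarrow> real"
    where "N = (\<lambda>M g r. \<Sum>j\<in>{j\<in>M. fst (g j) = r}. snd (g j) * x j)"
  have vi: "v i \<in> V" using insert.prems by auto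
  have V: "V = insert (v i) V'" "v i \<notin> V'" "finite V'" using insert.prems by (auto simp: V'_def)
  have cardV: "card V = Suc (card V')" using V by simp
  have cJ: "card (insert i J) = Suc (card J)" using insert.hyps by simp
  have V'ne: "V' \<noteq> {}" using insert.prems(5) cJ cardV by auto
  have "card V \<ge> 1" using cardV by simp
  have finW: "finite (set_pmf W)" unfolding W_def using insert.prems by (auto intro!: finite_set_Pi_pmf)
  have finU: "finite (set_pmf (U V'))" unfolding U_def using V V'ne by simp
  \<comment> \<open>The moment hypothesis for an empty set of items already forces every
    \<open>c l\<close> to be nonnegative.\<close>
  have c0: "0 \<le> c l" if "l \<in> insert i J" for l
  proof -
    have "0 \<le> E (Pi_pmf {} 0 (\<lambda>_. lazy_sign (1 / real (card V)))) (\<lambda>w. f l (\<Sum>j\<in>{}. w j * x j))"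
      using insert.prems(6)[OF that] by simp
    also have "\<dots> \<le> c l" using insert.prems(5) cJ by (intro insert.prems(7)[OF that]) auto
    finally show ?thesis .
  qed
  let ?q = "\<lambda>w. if w = 0 then U V' else return_pmf (v i, w)"
  \<comment> \<open>\<open>w\<close> records which items lie in bin \<open>v i\<close> and with
    which sign; the items with \<open>w j = 0\<close> remain undecided.\<close>
  have "Pi_pmf M d (\<lambda>_. U V) = bind_pmf W (\<lambda>w. Pi_pmf M d (\<lambda>j. ?q (w j)))"
  proof -
    have "U V = bind_pmf (lazy_sign p) ?q"
      unfolding U_def p_def V(1) using V V'ne by (intro uniform_bin_peel) auto
    then show ?thesis unfolding W_def using insert.prems(1) by (simp add: Pi_pmf_bind[where d' = 0])
  qed
  then have "E (Pi_pmf M d (\<lambda>_. U V)) (\<lambda>g. \<Prod>l\<in>insert i J. f l (N M g (v l))) =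
      E W (\<lambda>w. E (Pi_pmf M d (\<lambda>j. ?q (w j))) (\<lambda>g. \<Prod>l\<in>insert i J. f l (N M g (v l))))"
    using finW finU insert.prems(1) by (simp add: E_bind finite_set_Pi_pmf)
  also have "\<dots> \<le> E W (\<lambda>w. f i (\<Sum>j\<in>M. w j * x j) * (\<Prod>l\<in>J. c l))"
  proof (intro E_finite_mono finW)
    fix w :: "'a \<Rightarrow> real"
    define M' where "M' = {j\<in>M. w j = 0}"
    define P where "P = Pi_pmf M d (\<lambda>j. ?q (w j))"
    have M': "finite M'" "M' \<subseteq> M" using insert.prems(1) by (auto simp: M'_def)
    have "E P (\<lambda>g. \<Prod>l\<in>insert i J. f l (N M g (v l))) =
      E P (\<lambda>g. f i (\<Sum>j\<in>M. w j * x j) * (\<Prod>l\<in>J. f l (N M' (\<lambda>j. if j \<in> M' then g j else d) (v l))))"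
    proof (intro E_cong)
      fix g assume "g \<in> set_pmf P"
      then have g: "j \<in> M \<Longrightarrow> w j \<noteq> 0 \<Longrightarrow> g j = (v i, w j)" "j \<in> M \<Longrightarrow> w j = 0 \<Longrightarrow> fst (g j) \<in> V'" for j
        unfolding P_def using insert.prems(1) V V'ne
        by (auto simp: set_Pi_pmf PiE_dflt_def U_def split: if_splits)
          (smt (verit, best) mem_Sigma_iff prod.collapse finite_cartesian_product finite.emptyI
            finite_insert insert_not_empty set_pmf_of_set Sigma_empty_iff)
      have "N M g (v i) = (\<Sum>j\<in>M. w j * x j)"
        unfolding N_def
      proof (intro sum.mono_neutral_cong_left ballI)
        fix j assume "j \<in> M - {j \<in> M. fst (g j) = v i}"
        then show "w j * x j = 0" using g(1)[of j] by (cases "w j = 0") auto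
      next
        fix j assume "j \<in> {j \<in> M. fst (g j) = v i}"
        then show "snd (g j) * x j = w j * x j"
          using g(1)[of j] g(2)[of j] V(2) by (cases "w j = 0") auto
      qed (use insert.prems(1) in auto)
      \<comment> \<open>The other bins of \<open>J\<close> differ from \<open>v i\<close>, so only
        undecided items can reach them.\<close>
      moreover have "N M g (v l) = N M' (\<lambda>j. if j \<in> M' then g j else d) (v l)" if "l \<in> J" for l
      proof -
        have "v l \<noteq> v i" using that insert.prems(3) insert.hyps by (auto simp: inj_on_def)
        then have "{j \<in> M. fst (g j) = v l} = {j \<in> M'. fst (if j \<in> M' then g j else d) = v l}"
          using g by (auto simp: M'_def)
        then show ?thesis unfolding N_def by (intro sum.cong) auto
      qed
      ultimately show "(\<Prod>l\<in>insert i J. f l (N M g (v l))) =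
          f i (\<Sum>j\<in>M. w j * x j) * (\<Prod>l\<in>J. f l (N M' (\<lambda>j. if j \<in> M' then g j else d) (v l)))"
        using insert.hyps by simp
    qed
    also have "\<dots> = f i (\<Sum>j\<in>M. w j * x j) * E (map_pmf (\<lambda>g j. if j \<in> M' then g j else d) P) (\<lambda>g. \<Prod>l\<in>J. f l (N M' g (v l)))"
      by simp
    also have "map_pmf (\<lambda>g j. if j \<in> M' then g j else d) P = Pi_pmf M' d (\<lambda>_. U V')"
      unfolding P_def using insert.prems(1) M'
      by (subst Pi_pmf_subset[symmetric]) (auto intro!: Pi_pmf_cong simp: M'_def)
    also have "f i (\<Sum>j\<in>M. w j * x j) * E (Pi_pmf M' d (\<lambda>_. U V')) (\<lambda>g. \<Prod>l\<in>J. f l (N M' g (v l))) \<le>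
        f i (\<Sum>j\<in>M. w j * x j) * (\<Prod>l\<in>J. c l)"
      unfolding U_def N_def
    proof (intro mult_left_mono insert.IH)
      show "inj_on v J" using insert.prems(3) by (auto simp: inj_on_def)
      show "v ` J \<subseteq> V'" using insert.prems(3,4) insert.hyps by (auto simp: V'_def inj_on_def)
      show "card J < card V'" using insert.prems(5) cardV cJ by simp
      show "0 \<le> f i (\<Sum>j\<in>M. w j * x j)" using insert.prems(6) by simp
      \<comment> \<open>Removing one bin and one index together leaves the lower limit on
        \<open>m\<close> unchanged, so the moment hypothesis covers every stage.\<close>
      fix l M'' and m :: nat
      assume "l \<in> J" "M'' \<subseteq> M'" "card V' - card J < m" "m \<le> card V'"
      then show "E (Pi_pmf M'' 0 (\<lambda>_. lazy_sign (1 / real m))) (\<lambda>w. f l (\<Sum>j\<in>M''. w j * x j)) \<le> c l"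
        using M' cardV cJ by (intro insert.prems(7)) auto
    qed (use M' V insert.prems(6) in auto)
    finally show "E (Pi_pmf M d (\<lambda>j. ?q (w j))) (\<lambda>g. \<Prod>l\<in>insert i J. f l (N M g (v l)))
      \<le> f i (\<Sum>j\<in>M. w j * x j) * (\<Prod>l\<in>J. c l)" by (simp add: P_def)
  qed
  also have "\<dots> = E W (\<lambda>w. f i (\<Sum>j\<in>M. w j * x j)) * (\<Prod>l\<in>J. c l)" by simp
  also have "\<dots> \<le> c i * (\<Prod>l\<in>J. c l)"
    unfolding W_def p_def using insert.prems(5) cJ c0
    by (intro mult_right_mono insert.prems(7) prod_nonneg) auto
  finally show ?case using insert.hyps by (simp add: U_def N_def)
qed simp

section \<open>One row of the sketch\<close>

text \<open>Bin and sign of an item are drawn jointly; the default \<open>(0, 1)\<close> is the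
  value that \<open>hash_space\<close> fixes outside the range.\<close>

definition row_pmf :: "nat \<Rightarrow> nat \<Rightarrow> (nat \<Rightarrow> nat \<times> real) pmf" where
  "row_pmf C n = Pi_pmf {..<n} (0, 1) (\<lambda>_. pmf_of_set ({..<C} \<times> {1, -1}))"

text \<open>The signed noise from the other items in the bin of \<open>i\<close>, which is what the
  row adds to \<open>x i\<close> in its estimate.\<close>

definition row_err :: "nat \<Rightarrow> (nat \<Rightarrow> real) \<Rightarrow> (nat \<Rightarrow> nat \<times> real) \<Rightarrow> nat \<Rightarrow> real" where
  "row_err n x g i = (\<Sum>j\<in>{j. j < n \<and> j \<noteq> i \<and> fst (g j) = fst (g i)}. snd (g i) * snd (g j) * x j)"

text \<open>A sign rather than an indicator, so that exceedance in at least half of the rows is a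
  nonnegative sum; \<open>\<sigma>\<close> picks the direction of the error.\<close>

definition exceeds :: "real \<Rightarrow> real \<Rightarrow> real \<Rightarrow> real" where
  "exceeds \<sigma> \<tau> e = (if \<sigma> * e > \<tau> then 1 else -1)"

lemma abs_exceeds [simp]: "\<bar>exceeds \<sigma> \<tau> e\<bar> = 1"
  by (simp add: exceeds_def)

lemma finite_set_row_pmf [simp]: "C > 0 \<Longrightarrow> finite (set_pmf (row_pmf C n))"
  unfolding row_pmf_def by (intro finite_set_Pi_pmf, simp, subst set_pmf_of_set) auto

text \<open>Fix the bins and signs of the items of \<open>J\<close>. When these bins are distinct,
  no item of \<open>J\<close> disturbs another and all noise comes from items outside
  \<open>J\<close>. Exposing the bins in turn gives each factor mean at most
  \<open>1 - \<theta> i * \<rho> i\<close>, and the probability of distinct bins factors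
  out.\<close>

lemma E_row_distinct:
  fixes \<theta> \<rho> \<tau> \<sigma> :: "nat \<Rightarrow> real"
  assumes J: "J \<subseteq> {..<n}" "card J < C"
    and \<theta>: "\<And>i. i \<in> J \<Longrightarrow> 0 \<le> \<theta> i \<and> \<theta> i \<le> 1"
    and \<sigma>: "\<And>i. i \<in> J \<Longrightarrow> \<sigma> i = 1 \<or> \<sigma> i = -1"
    and \<tau>: "\<And>i. i \<in> J \<Longrightarrow> \<tau> i \<ge> 0"
    and ball: "\<And>i M m. i \<in> J \<Longrightarrow> M \<subseteq> {..<n} \<Longrightarrow> C - card J < m \<Longrightarrow> m \<le> C \<Longrightarrow>
      \<rho> i \<le> E (Pi_pmf M 0 (\<lambda>_. lazy_sign (1 / real m))) (\<lambda>w. of_bool (\<bar>\<Sum>j\<in>M. w j * x j\<bar> \<le> \<tau> i))"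
  shows "E (row_pmf C n) (\<lambda>g. of_bool (inj_on (fst \<circ> g) J) *
      (\<Prod>i\<in>J. 1 + \<theta> i * exceeds (\<sigma> i) (\<tau> i) (row_err n x g i)))
    \<le> E (row_pmf C n) (\<lambda>g. of_bool (inj_on (fst \<circ> g) J)) * (\<Prod>i\<in>J. 1 - \<theta> i * \<rho> i)"
proof -
  define M where "M = {..<n} - J"
  define Q where "Q = pmf_of_set ({..<C} \<times> {1, -1 :: real})"
  have C: "C > 0" using J by simp
  have setQ: "set_pmf Q = {..<C} \<times> {1, -1}" unfolding Q_def using C by (subst set_pmf_of_set) auto
  have finJ: "finite J" using J finite_subset by blast
  have un: "{..<n} = J \<union> M" "finite M" "J \<inter> M = {}" using J by (auto simp: M_def)
  have finP: "finite (set_pmf (Pi_pmf A d (\<lambda>_. Q)))" if "finite A" for A :: "nat set" and d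
    using that setQ by (intro finite_set_Pi_pmf) auto
  have split: "E (row_pmf C n) F = E (Pi_pmf J (0, 1) (\<lambda>_. Q)) (\<lambda>f. E (Pi_pmf M (0, 1) (\<lambda>_. Q)) (\<lambda>g. F (\<lambda>x. if x \<in> J then f x else g x)))" for F
    unfolding row_pmf_def un(1) Q_def[symmetric] using un finJ setQ by (intro E_Pi_union) auto
  have inj: "inj_on (fst \<circ> (\<lambda>x. if x \<in> J then f x else g x)) J \<longleftrightarrow> inj_on (fst \<circ> f) J" for f g :: "nat \<Rightarrow> nat \<times> real"
    by (intro inj_on_cong) auto
  let ?B = "\<Prod>i\<in>J. 1 - \<theta> i * \<rho> i"
  have "E (row_pmf C n) (\<lambda>g. of_bool (inj_on (fst \<circ> g) J) *
      (\<Prod>i\<in>J. 1 + \<theta> i * exceeds (\<sigma> i) (\<tau> i) (row_err n x g i))) \<le>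
    E (Pi_pmf J (0, 1) (\<lambda>_. Q)) (\<lambda>f. of_bool (inj_on (fst \<circ> f) J) * ?B)"
    unfolding split inj
  proof (intro E_finite_mono finP finJ)
    fix f assume f: "f \<in> set_pmf (Pi_pmf J (0, 1) (\<lambda>_. Q))"
    have fs: "fst (f i) < C" "snd (f i) = 1 \<or> snd (f i) = -1" if "i \<in> J" for i
      using f that finJ by (auto simp: set_Pi_pmf PiE_dflt_def setQ mem_Times_iff)
    show "E (Pi_pmf M (0, 1) (\<lambda>_. Q)) (\<lambda>g. of_bool (inj_on (fst \<circ> f) J) *
      (\<Prod>i\<in>J. 1 + \<theta> i * exceeds (\<sigma> i) (\<tau> i) (row_err n x (\<lambda>x. if x \<in> J then f x else g x) i)))
      \<le> of_bool (inj_on (fst \<circ> f) J) * ?B"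
    proof (cases "inj_on (fst \<circ> f) J")
      case True
      \<comment> \<open>The sign of item \<open>i\<close> multiplies its whole bin sum, so it merges
        with the direction \<open>\<sigma> i\<close>.\<close>
      define F where "F = (\<lambda>i z. 1 + \<theta> i * (if (\<sigma> i * snd (f i)) * z > \<tau> i then 1 else -1) :: real)"
      have "E (Pi_pmf M (0, 1) (\<lambda>_. Q)) (\<lambda>g. \<Prod>i\<in>J. 1 + \<theta> i * exceeds (\<sigma> i) (\<tau> i) (row_err n x (\<lambda>x. if x \<in> J then f x else g x) i))
        = E (Pi_pmf M (0, 1) (\<lambda>_. Q)) (\<lambda>g. \<Prod>i\<in>J. F i (\<Sum>j\<in>{j\<in>M. fst (g j) = (fst \<circ> f) i}. snd (g j) * x j))"
      proof (intro E_cong prod.cong refl)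
        fix g i assume i: "i \<in> J"
        have "{j. j < n \<and> j \<noteq> i \<and> fst (if j \<in> J then f j else g j) = fst (f i)} = {j\<in>M. fst (g j) = fst (f i)}"
          using i un True J by (auto simp: inj_on_def M_def)
        then have set: "{j. j < n \<and> j \<noteq> i \<and> fst (if j \<in> J then f j else g j) = fst (if i \<in> J then f i else g i)} = {j\<in>M. fst (g j) = fst (f i)}"
          using i by (simp only: if_True)
        have "row_err n x (\<lambda>x. if x \<in> J then f x else g x) i =
            (\<Sum>j\<in>{j\<in>M. fst (g j) = fst (f i)}. snd (f i) * (snd (g j) * x j))"
          unfolding row_err_def set
        proof (intro sum.cong refl)
          fix j assume "j \<in> {j\<in>M. fst (g j) = fst (f i)}"
          then have "j \<notin> J" using un by auto
          then show "snd (if i \<in> J then f i else g i) * snd (if j \<in> J then f j else g j) * x j = snd (f i) * (snd (g j) * x j)"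
            using i by simp
        qed
        then have "row_err n x (\<lambda>x. if x \<in> J then f x else g x) i =
            snd (f i) * (\<Sum>j\<in>{j\<in>M. fst (g j) = fst (f i)}. snd (g j) * x j)"
          by (simp only: sum_distrib_left)
        then show "1 + \<theta> i * exceeds (\<sigma> i) (\<tau> i) (row_err n x (\<lambda>x. if x \<in> J then f x else g x) i) =
            F i (\<Sum>j\<in>{j\<in>M. fst (g j) = (fst \<circ> f) i}. snd (g j) * x j)"
          by (simp add: F_def exceeds_def mult.assoc)
      qed
      also have "\<dots> \<le> ?B"
        unfolding Q_def
      proof (rule E_distinct_bins)
        show "card J < card {..<C}" using J by simp
        show "(fst \<circ> f) ` J \<subseteq> {..<C}" using fs by auto
        show "0 \<le> F i z" if "i \<in> J" for i z using \<theta>[OF that] by (simp add: F_def)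
        fix i M' and m :: nat
        assume a: "i \<in> J" "M' \<subseteq> M" "card {..<C} - card J < m" "m \<le> card {..<C}"
        have finM': "finite M'" using a un finite_subset by blast
        have m: "m > 0" using a by simp
        let ?W = "Pi_pmf M' 0 (\<lambda>_. lazy_sign (1 / real m))"
        have finW: "finite (set_pmf ?W)" using finM' by (intro finite_set_Pi_pmf) auto
        have "E ?W (\<lambda>w. F i (\<Sum>j\<in>M'. w j * x j)) =
          1 + \<theta> i * E ?W (\<lambda>w. if (\<sigma> i * snd (f i)) * (\<Sum>j\<in>M'. w j * x j) > \<tau> i then 1 else -1)"
          unfolding F_def by (simp only: E_finite_add[OF finW]) simp
        also have "\<dots> = 1 - \<theta> i * E ?W (\<lambda>w. of_bool (\<bar>\<Sum>j\<in>M'. w j * x j\<bar> \<le> \<tau> i))"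
          using finM' m \<tau>[OF a(1)] \<sigma>[OF a(1)] fs(2)[OF a(1)]
          by (subst lazy_sum_one_sided) auto
        also have "\<dots> \<le> 1 - \<theta> i * \<rho> i"
          using \<theta>[OF a(1)] ball[of i M' m] a un by (auto intro!: mult_left_mono)
        finally show "E ?W (\<lambda>w. F i (\<Sum>j\<in>M'. w j * x j)) \<le> 1 - \<theta> i * \<rho> i" .
      qed (use finJ un True in \<open>auto simp: comp_def\<close>)
      finally show ?thesis using True by simp
    qed simp
  qed
  also have "\<dots> = E (row_pmf C n) (\<lambda>g. of_bool (inj_on (fst \<circ> g) J)) * ?B"
    unfolding split inj by simp
  finally show ?thesis .
qed

section \<open>Sign symmetry and collisions within a row\<close>

lemma E_row_flip:
  assumes "i < n" "C > 0"
  shows "E (row_pmf C n) F = E (row_pmf C n) (\<lambda>g. F (g(i := (fst (g i), - snd (g i)))))"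
proof -
  define Q where "Q = pmf_of_set ({..<C} \<times> {1, -1 :: real})"
  have finQ: "finite (set_pmf Q)" unfolding Q_def using assms by (subst set_pmf_of_set) auto
  define A where "A = {..<n} - {i}"
  have A: "{..<n} = insert i A" "finite A" "i \<notin> A" using assms by (auto simp: A_def)
  have split: "E (row_pmf C n) G = E Q (\<lambda>y. E (Pi_pmf A (0, 1) (\<lambda>_. Q)) (\<lambda>f. G (f(i := y))))" for G
    unfolding row_pmf_def Q_def[symmetric] A(1) using A finQ by (intro E_Pi_insert) auto
  have "map_pmf (\<lambda>y. (fst y, - snd y)) Q = Q"
    unfolding Q_def using assms
    by (intro map_pmf_of_set_bij_betw bij_betw_byWitness[where f' = "\<lambda>y. (fst y, - snd y)"]) auto
  then have flip: "E Q G = E Q (\<lambda>y. G (fst y, - snd y))" for G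
    by (metis integral_map_pmf)
  show ?thesis unfolding split by (subst flip) simp
qed

text \<open>Reversing the sign of item \<open>i\<close> preserves the law and all bins but negates
  its error. As \<open>\<tau> \<ge> 0\<close>, an error and its negative cannot both exceed \<tau>,
  so the two exceedance signs add up to at most zero.\<close>

lemma E_row_err_exceeds_nonpos:
  assumes "i < n" "C > 0" "\<tau> \<ge> 0"
  shows "E (row_pmf C n) (\<lambda>g. of_bool (P (fst \<circ> g)) * exceeds \<sigma> \<tau> (row_err n x g i)) \<le> 0"
proof -
  let ?R = "row_pmf C n"
  let ?fl = "\<lambda>g :: nat \<Rightarrow> nat \<times> real. g(i := (fst (g i), - snd (g i)))"
  have fst: "fst \<circ> ?fl g = fst \<circ> g" for g by auto
  have err: "row_err n x (?fl g) i = - row_err n x g i" for g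
  proof -
    have "{j. j < n \<and> j \<noteq> i \<and> fst ((?fl g) j) = fst ((?fl g) i)} = {j. j < n \<and> j \<noteq> i \<and> fst (g j) = fst (g i)}"
      by auto
    then show ?thesis unfolding row_err_def sum_negf[symmetric] by (intro sum.cong) auto
  qed
  define F where "F = (\<lambda>g. of_bool (P (fst \<circ> g)) * exceeds \<sigma> \<tau> (row_err n x g i))"
  have "2 * E ?R F = E ?R F + E ?R (\<lambda>g. F (?fl g))"
    using E_row_flip[OF assms(1,2), of F] by simp
  also have "\<dots> = E ?R (\<lambda>g. F g + F (?fl g))"
    using assms by (subst E_finite_add) auto
  also have "\<dots> \<le> E ?R (\<lambda>g. 0)"
    using assms unfolding F_def fst err
    by (intro E_finite_mono) (auto simp: exceeds_def)
  finally show ?thesis by (simp add: F_def)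
qed

text \<open>Expand the product: the terms of degree at least two are bounded by their values at
  \<open>Y = 1\<close>, which sum to the last bracket.\<close>

lemma prod_one_plus_le:
  fixes \<theta> Y :: "'a \<Rightarrow> real"
  assumes "finite J" "\<And>i. i \<in> J \<Longrightarrow> 0 \<le> \<theta> i" "\<And>i. i \<in> J \<Longrightarrow> \<bar>Y i\<bar> \<le> 1"
  shows "(\<Prod>i\<in>J. 1 + \<theta> i * Y i) \<le> 1 + (\<Sum>i\<in>J. \<theta> i * Y i) + ((\<Prod>i\<in>J. 1 + \<theta> i) - 1 - (\<Sum>i\<in>J. \<theta> i))"
proof -
  \<comment> \<open>The first conjunct is needed for the induction: it bounds the cross term
    \<open>\<theta> i * Y i * (?P - 1)\<close> by \<open>\<theta> i * (?T - 1)\<close>.\<close>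
  have "\<bar>(\<Prod>i\<in>J. 1 + \<theta> i * Y i) - 1\<bar> \<le> (\<Prod>i\<in>J. 1 + \<theta> i) - 1 \<and>
    (\<Prod>i\<in>J. 1 + \<theta> i * Y i) \<le> 1 + (\<Sum>i\<in>J. \<theta> i * Y i) + ((\<Prod>i\<in>J. 1 + \<theta> i) - 1 - (\<Sum>i\<in>J. \<theta> i))"
    using assms
  proof (induction J rule: finite_induct)
    case (insert i J)
    let ?P = "\<Prod>i\<in>J. 1 + \<theta> i * Y i" and ?T = "\<Prod>i\<in>J. 1 + \<theta> i"
    have IH: "\<bar>?P - 1\<bar> \<le> ?T - 1" "?P \<le> 1 + (\<Sum>i\<in>J. \<theta> i * Y i) + (?T - 1 - (\<Sum>i\<in>J. \<theta> i))"
      using insert by auto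
    have Y: "\<bar>\<theta> i * Y i\<bar> \<le> \<theta> i" "0 \<le> \<theta> i"
      using insert.prems mult_left_mono[of "\<bar>Y i\<bar>" 1 "\<theta> i"] by (auto simp: abs_mult)
    have a: "\<bar>\<theta> i * Y i * (?P - 1)\<bar> \<le> \<theta> i * (?T - 1)"
      unfolding abs_mult[of "\<theta> i * Y i"] using Y IH by (intro mult_mono) auto
    have "(1 + \<theta> i * Y i) * ?P = ?P + \<theta> i * Y i + \<theta> i * Y i * (?P - 1)" by (simp add: algebra_simps)
    moreover have "(1 + \<theta> i) * ?T = ?T + \<theta> i + \<theta> i * (?T - 1)" by (simp add: algebra_simps)
    ultimately have "\<bar>(1 + \<theta> i * Y i) * ?P - 1\<bar> \<le> (1 + \<theta> i) * ?T - 1"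
      "(1 + \<theta> i * Y i) * ?P \<le> 1 + (\<theta> i * Y i + (\<Sum>i\<in>J. \<theta> i * Y i)) + ((1 + \<theta> i) * ?T - 1 - (\<theta> i + (\<Sum>i\<in>J. \<theta> i)))"
      using a Y IH by linarith+
    then show ?case using insert.hyps by simp
  qed simp
  then show ?thesis by simp
qed

text \<open>Colliding rows are unbiased by the sign symmetry, so they only cost a second-order term.\<close>
lemma E_row_collide:
  fixes \<theta> \<tau> \<sigma> :: "nat \<Rightarrow> real"
  assumes J: "J \<subseteq> {..<n}" and C: "C > 0"
    and \<theta>: "\<And>i. i \<in> J \<Longrightarrow> 0 \<le> \<theta> i"
    and \<tau>: "\<And>i. i \<in> J \<Longrightarrow> \<tau> i \<ge> 0"
  defines "S \<equiv> \<Sum>i\<in>J. \<theta> i"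
  shows "E (row_pmf C n) (\<lambda>g. of_bool (\<not> inj_on (fst \<circ> g) J) *
      (\<Prod>i\<in>J. 1 + \<theta> i * exceeds (\<sigma> i) (\<tau> i) (row_err n x g i)))
    \<le> E (row_pmf C n) (\<lambda>g. of_bool (\<not> inj_on (fst \<circ> g) J)) * (exp S - S)"
proof -
  let ?R = "row_pmf C n"
  let ?D = "\<lambda>g :: nat \<Rightarrow> nat \<times> real. of_bool (\<not> inj_on (fst \<circ> g) J) :: real"
  let ?Y = "\<lambda>g i. exceeds (\<sigma> i) (\<tau> i) (row_err n x g i)"
  have finJ: "finite J" using J finite_subset by blast
  have finR: "finite (set_pmf ?R)" using C by simp
  have "E ?R (\<lambda>g. ?D g * (\<Prod>i\<in>J. 1 + \<theta> i * ?Y g i)) \<le>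
    E ?R (\<lambda>g. (\<Sum>i\<in>J. \<theta> i * (?D g * ?Y g i)) + ?D g * (exp S - S))"
  proof (intro E_finite_mono finR)
    fix g
    have "(\<Prod>i\<in>J. 1 + \<theta> i) \<le> (\<Prod>i\<in>J. exp (\<theta> i))"
      using \<theta> by (intro prod_mono) (auto intro: add_nonneg_nonneg)
    then have "(\<Prod>i\<in>J. 1 + \<theta> i) \<le> exp S" using finJ by (simp add: S_def exp_sum)
    then have "(\<Prod>i\<in>J. 1 + \<theta> i * ?Y g i) \<le> (\<Sum>i\<in>J. \<theta> i * ?Y g i) + (exp S - S)"
      using prod_one_plus_le[of J \<theta> "?Y g"] finJ \<theta> by (simp add: S_def)
    then have "?D g * (\<Prod>i\<in>J. 1 + \<theta> i * ?Y g i) \<le> ?D g * ((\<Sum>i\<in>J. \<theta> i * ?Y g i) + (exp S - S))"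
      by (intro mult_left_mono) auto
    then show "?D g * (\<Prod>i\<in>J. 1 + \<theta> i * ?Y g i) \<le> (\<Sum>i\<in>J. \<theta> i * (?D g * ?Y g i)) + ?D g * (exp S - S)"
      by (simp add: distrib_left sum_distrib_left mult_ac)
  qed
  also have "\<dots> = (\<Sum>i\<in>J. \<theta> i * E ?R (\<lambda>g. ?D g * ?Y g i)) + E ?R ?D * (exp S - S)"
    by (simp only: E_finite_add[OF finR] E_finite_sum[OF finR]) simp
  also have "(\<Sum>i\<in>J. \<theta> i * E ?R (\<lambda>g. ?D g * ?Y g i)) \<le> 0"
    using J C \<theta> \<tau> by (intro sum_nonpos mult_nonneg_nonpos E_row_err_exceeds_nonpos) auto
  finally show ?thesis by linarith
qed

text \<open>Union bound over ordered pairs of distinct items, each sharing a bin with probability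
  \<open>1 / real C\<close>.\<close>

lemma E_row_collision:
  assumes J: "J \<subseteq> {..<n}" and C: "C > 0"
  shows "E (row_pmf C n) (\<lambda>g. of_bool (\<not> inj_on (fst \<circ> g) J)) \<le> (real (card J))\<^sup>2 / real C"
proof -
  let ?R = "row_pmf C n"
  define Q where "Q = pmf_of_set ({..<C} \<times> {1, -1 :: real})"
  have setQ: "set_pmf Q = {..<C} \<times> {1, -1}" unfolding Q_def using C by (subst set_pmf_of_set) auto
  have finJ: "finite J" using J finite_subset by blast
  have finR: "finite (set_pmf ?R)" using C by simp
  define P where "P = {(i, j). i \<in> J \<and> j \<in> J \<and> i \<noteq> j}"
  have P: "P \<subseteq> J \<times> J" by (auto simp: P_def)
  then have finP: "finite P" using finJ finite_subset by blast
  have pair: "E ?R (\<lambda>g. of_bool (fst (g i) = fst (g j))) = 1 / real C" if "(i, j) \<in> P" for i j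
  proof -
    define A where "A = {..<n} - {i}"
    have ij: "i < n" "j < n" "i \<noteq> j" using that J by (auto simp: P_def)
    then have A: "{..<n} = insert i A" "finite A" "i \<notin> A" "j \<in> A" by (auto simp: A_def)
    have finA: "finite (set_pmf (Pi_pmf A d (\<lambda>_. Q)))" for d
      using A setQ by (intro finite_set_Pi_pmf) auto
    have "E ?R (\<lambda>g. of_bool (fst (g i) = fst (g j))) =
        E Q (\<lambda>y. E (Pi_pmf A (0, 1) (\<lambda>_. Q)) (\<lambda>f. of_bool (fst y = fst (f j))))"
      unfolding row_pmf_def Q_def[symmetric] A(1) using A ij setQ by (subst E_Pi_insert) auto
    also have "\<dots> = E (Pi_pmf A (0, 1) (\<lambda>_. Q)) (\<lambda>f. E Q (\<lambda>y. of_bool (fst y = fst (f j))))"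
      using finA setQ by (intro E_swap) auto
    also have "\<dots> = E (Pi_pmf A (0, 1) (\<lambda>_. Q)) (\<lambda>f. 1 / real C)"
    proof (intro E_cong)
      fix f assume "f \<in> set_pmf (Pi_pmf A (0, 1) (\<lambda>_. Q))"
      then have f: "fst (f j) < C" using A by (auto simp: set_Pi_pmf PiE_dflt_def setQ mem_Times_iff)
      have "E Q (\<lambda>y. of_bool (fst y = fst (f j))) =
          (\<Sum>y\<in>{..<C} \<times> {1, -1 :: real}. of_bool (fst y = fst (f j))) / real (C * 2)"
        unfolding Q_def using C by (subst integral_pmf_of_set) (auto simp: card_cartesian_product)
      also have "(\<Sum>y\<in>{..<C} \<times> {1, -1 :: real}. of_bool (fst y = fst (f j))) =
          (\<Sum>v\<in>{..<C}. \<Sum>s\<in>{1, -1 :: real}. of_bool (v = fst (f j)) :: real)"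
        unfolding sum.cartesian_product by (simp only: case_prod_unfold)
      also have "\<dots> = (\<Sum>v\<in>{..<C}. if v = fst (f j) then 2 else 0)" by (intro sum.cong) auto
      also have "\<dots> = 2" using f by simp
      also have "2 / real (C * 2) = 1 / real C" by simp
      finally show "E Q (\<lambda>y. of_bool (fst y = fst (f j))) = 1 / real C" .
    qed
    finally show ?thesis by simp
  qed
  have "E ?R (\<lambda>g. of_bool (\<not> inj_on (fst \<circ> g) J)) \<le> E ?R (\<lambda>g. \<Sum>p\<in>P. of_bool (fst (g (fst p)) = fst (g (snd p))))"
  proof (intro E_finite_mono finR)
    fix g :: "nat \<Rightarrow> nat \<times> real"
    show "of_bool (\<not> inj_on (fst \<circ> g) J) \<le> (\<Sum>p\<in>P. of_bool (fst (g (fst p)) = fst (g (snd p))) :: real)"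
    proof (cases "inj_on (fst \<circ> g) J")
      case False
      then obtain i j where "(i, j) \<in> P" "fst (g i) = fst (g j)" by (auto simp: inj_on_def P_def)
      then have "of_bool (fst (g (fst (i, j))) = fst (g (snd (i, j)))) \<le> (\<Sum>p\<in>P. of_bool (fst (g (fst p)) = fst (g (snd p))) :: real)"
        using finP by (intro member_le_sum) auto
      then show ?thesis using False \<open>fst (g i) = fst (g j)\<close> by simp
    qed (auto intro: sum_nonneg)
  qed
  also have "\<dots> = (\<Sum>p\<in>P. 1 / real C)"
    using pair by (simp only: E_finite_sum[OF finR]) (auto intro!: sum.cong)
  also have "\<dots> \<le> (real (card J))\<^sup>2 / real C"
  proof -
    have "card P \<le> card J * card J" using P finJ card_mono[of "J \<times> J" P] by (simp add: card_cartesian_product)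
    then have "real (card P) \<le> real (card J * card J)" by (simp only: of_nat_le_iff)
    then show ?thesis by (simp add: divide_right_mono power2_eq_square)
  qed
  finally show ?thesis .
qed

text \<open>With weights \<open>\<rho> i / 4\<close> the collision-free rows give the factor
  \<open>exp (- y)\<close>, where \<open>y\<close> is a quarter of the sum of the squared
  \<open>\<rho> i\<close>. Collisions add at most \<open>y * exp (- y) / 2\<close> by the smallness
  hypothesis \<open>q\<close>, so half of the exponent survives. The numbers 1/80 and 1/1600 are the
  largest possible contributions of one item to \<open>S\<close> and \<open>y\<close>.\<close>

lemma E_row_exp_bound:
  fixes \<rho> \<tau> \<sigma> :: "nat \<Rightarrow> real" and q :: nat
  assumes J: "J \<subseteq> {..<n}" "card J \<le> q" "q < C"
    and \<sigma>: "\<And>i. i \<in> J \<Longrightarrow> \<sigma> i = 1 \<or> \<sigma> i = -1"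
    and \<tau>: "\<And>i. i \<in> J \<Longrightarrow> \<tau> i \<ge> 0"
    and \<rho>: "\<And>i. i \<in> J \<Longrightarrow> 0 \<le> \<rho> i \<and> \<rho> i \<le> 1/20"
    and ball: "\<And>i M m. i \<in> J \<Longrightarrow> M \<subseteq> {..<n} \<Longrightarrow> C - card J < m \<Longrightarrow> m \<le> C \<Longrightarrow>
      \<rho> i \<le> E (Pi_pmf M 0 (\<lambda>_. lazy_sign (1 / real m))) (\<lambda>w. of_bool (\<bar>\<Sum>j\<in>M. w j * x j\<bar> \<le> \<tau> i))"
    and q: "(real q)\<^sup>2 / real C * (1 + real q * exp (real q / 80)) \<le> exp (- real q / 1600) / 2"
  shows "E (row_pmf C n) (\<lambda>g. \<Prod>i\<in>J. 1 + \<rho> i / 4 * exceeds (\<sigma> i) (\<tau> i) (row_err n x g i))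
    \<le> exp (- (\<Sum>i\<in>J. (\<rho> i)\<^sup>2) / 8)"
proof -
  let ?R = "row_pmf C n"
  let ?D = "\<lambda>g :: nat \<Rightarrow> nat \<times> real. of_bool (inj_on (fst \<circ> g) J) :: real"
  let ?D' = "\<lambda>g :: nat \<Rightarrow> nat \<times> real. of_bool (\<not> inj_on (fst \<circ> g) J) :: real"
  let ?F = "\<lambda>g. \<Prod>i\<in>J. 1 + \<rho> i / 4 * exceeds (\<sigma> i) (\<tau> i) (row_err n x g i)"
  have C: "C > 0" using J by simp
  have finJ: "finite J" using J finite_subset by blast
  have finR: "finite (set_pmf ?R)" using C by simp
  define S where "S = (\<Sum>i\<in>J. \<rho> i / 4)"
  define y where "y = (\<Sum>i\<in>J. \<rho> i / 4 * \<rho> i)"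
  define pc where "pc = E ?R ?D'"
  have \<rho>20: "\<rho> i * 20 \<le> 1" "\<rho> i \<ge> 0" if "i \<in> J" for i using \<rho>[OF that] by simp_all
  have S: "0 \<le> S" "S \<le> real q / 80"
  proof -
    show "0 \<le> S" unfolding S_def using \<rho> by (intro sum_nonneg) auto
    have "S \<le> real (card J) * (1/80)" unfolding S_def using \<rho>20 by (intro sum_bounded_above) (auto simp: mult.commute)
    also have "\<dots> \<le> real q * (1/80)" using J by (intro mult_right_mono) auto
    finally show "S \<le> real q / 80" by simp
  qed
  have y: "0 \<le> y" "y \<le> real q / 1600"
  proof -
    show "0 \<le> y" unfolding y_def using \<rho> by (intro sum_nonneg) auto
    have "\<rho> i / 4 * \<rho> i \<le> 1/80 * (1/20)" if "i \<in> J" for i using \<rho>[OF that] by (intro mult_mono) auto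
    then have "y \<le> real (card J) * (1/1600)" unfolding y_def by (intro sum_bounded_above) auto
    also have "\<dots> \<le> real q * (1/1600)" using J by (intro mult_right_mono) auto
    finally show "y \<le> real q / 1600" by simp
  qed
  \<comment> \<open>Cauchy-Schwarz makes the second-order cost of collisions proportional to
    \<open>y\<close>; a cost not vanishing with \<open>y\<close> could not be absorbed into the
    exponent.\<close>
  have S2: "S\<^sup>2 \<le> real q * y"
  proof -
    have "S\<^sup>2 \<le> (\<Sum>i\<in>J. (\<rho> i / 4)\<^sup>2) * real (card J)" unfolding S_def by (rule sum_squared_le_sum_of_squares)
    also have "\<dots> \<le> y * real q"
      unfolding y_def using J \<rho> by (intro mult_mono sum_mono sum_nonneg) (auto simp: power2_eq_square)
    finally show ?thesis by (simp add: mult.commute)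
  qed
  have pc: "0 \<le> pc" "pc \<le> (real q)\<^sup>2 / real C"
  proof -
    show "0 \<le> pc" unfolding pc_def by simp
    have "pc \<le> (real (card J))\<^sup>2 / real C" unfolding pc_def using J C by (intro E_row_collision) auto
    also have "\<dots> \<le> (real q)\<^sup>2 / real C" using J by (intro divide_right_mono power_mono) auto
    finally show "pc \<le> (real q)\<^sup>2 / real C" .
  qed
  have D: "E ?R ?D = 1 - pc"
  proof -
    have "E ?R ?D = E ?R (\<lambda>g. 1 - ?D' g)" by (intro E_cong) auto
    then show ?thesis by (simp only: E_finite_diff[OF finR] pc_def) simp
  qed
  then have pc1: "pc \<le> 1" using Bochner_Integration.integral_nonneg[of ?R ?D] by simp
  have collide: "E ?R (\<lambda>g. ?D' g * ?F g) \<le> pc * (exp S - S)"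
    unfolding pc_def S_def using J C \<rho> \<tau> by (intro E_row_collide) auto
  have "E ?R (\<lambda>g. ?D g * ?F g) \<le> E ?R ?D * (\<Prod>i\<in>J. 1 - \<rho> i / 4 * \<rho> i)"
  proof (rule E_row_distinct)
    show "0 \<le> \<rho> i / 4 \<and> \<rho> i / 4 \<le> 1" if "i \<in> J" for i using \<rho>20[OF that] by simp
    show "card J < C" using J by simp
    show "J \<subseteq> {..<n}" by (rule J)
    show "\<sigma> i = 1 \<or> \<sigma> i = -1" "0 \<le> \<tau> i" if "i \<in> J" for i using \<sigma> \<tau> that by auto
  qed (rule ball)
  also have "\<dots> \<le> (1 - pc) * exp (- y)"
  proof -
    have "(\<Prod>i\<in>J. 1 - \<rho> i / 4 * \<rho> i) \<le> (\<Prod>i\<in>J. exp (- (\<rho> i / 4 * \<rho> i)))"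
    proof (intro prod_mono conjI)
      fix i assume "i \<in> J"
      then have "\<rho> i / 4 * \<rho> i \<le> 1 * 1" using \<rho>[of i] by (intro mult_mono) auto
      then show "0 \<le> 1 - \<rho> i / 4 * \<rho> i" by simp
      show "1 - \<rho> i / 4 * \<rho> i \<le> exp (- (\<rho> i / 4 * \<rho> i))" using exp_ge_add_one_self[of "- (\<rho> i / 4 * \<rho> i)"] by simp
    qed
    also have "\<dots> = exp (- y)" using finJ by (simp add: y_def exp_sum sum_negf[symmetric])
    finally show ?thesis unfolding D using pc1 by (intro mult_left_mono) auto
  qed
  finally have distinct: "E ?R (\<lambda>g. ?D g * ?F g) \<le> (1 - pc) * exp (- y)" .
  have "E ?R ?F = E ?R (\<lambda>g. ?D g * ?F g + ?D' g * ?F g)"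
    by (intro E_cong) auto
  also have "\<dots> = E ?R (\<lambda>g. ?D g * ?F g) + E ?R (\<lambda>g. ?D' g * ?F g)"
    by (rule E_finite_add[OF finR])
  also have "\<dots> \<le> (1 - pc) * exp (- y) + pc * (exp S - S)"
    using collide distinct by (rule add_mono[rotated])
  also have "(1 - pc) * exp (- y) + pc * (exp S - S) = exp (- y) + pc * (exp S - S - exp (- y))"
    by (simp add: algebra_simps)
  \<comment> \<open>The difference is \<open>(exp S - 1 - S) + (1 - exp (- y))\<close>, which is at
    most \<open>S\<^sup>2 * exp S + y\<close>.\<close>
  also have "\<dots> \<le> exp (- y) + pc * (y * (1 + real q * exp (real q / 80)))"
  proof -
    have 1: "exp S - 1 \<le> S * exp S"
    proof -
      have "1 - S \<le> exp (- S)" using exp_ge_add_one_self[of "- S"] by simp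
      then have "(1 - S) * exp S \<le> exp (- S) * exp S" by (intro mult_right_mono) auto
      then show ?thesis by (simp add: exp_minus algebra_simps)
    qed
    have "S * (exp S - 1) \<le> S * (S * exp S)" using 1 S by (intro mult_left_mono) auto
    then have "exp S - S - exp (- y) \<le> S\<^sup>2 * exp S + y"
      using 1 exp_ge_add_one_self[of "- y"] by (simp add: power2_eq_square algebra_simps)
    also have "\<dots> \<le> (real q * y) * exp (real q / 80) + y"
      using S2 S y by (intro add_mono mult_mono) auto
    also have "\<dots> = y * (1 + real q * exp (real q / 80))" by (simp add: algebra_simps)
    finally show ?thesis using pc by (intro add_left_mono mult_left_mono)
  qed
  also have "\<dots> \<le> exp (- y) + (real q)\<^sup>2 / real C * (y * (1 + real q * exp (real q / 80)))"
    using pc y by (intro add_left_mono mult_right_mono) auto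
  also have "\<dots> = exp (- y) + y * ((real q)\<^sup>2 / real C * (1 + real q * exp (real q / 80)))" by simp
  also have "\<dots> \<le> exp (- y) + y * (exp (- y) / 2)"
  proof -
    have "exp (- real q / 1600) \<le> exp (- y)" using y by simp
    then have "(real q)\<^sup>2 / real C * (1 + real q * exp (real q / 80)) \<le> exp (- y) / 2"
      using q by linarith
    then show ?thesis using y by (intro add_left_mono mult_left_mono) auto
  qed
  also have "\<dots> = exp (- y) * (1 + y / 2)" by (simp add: algebra_simps)
  also have "\<dots> \<le> exp (- y) * exp (y / 2)"
    by (intro mult_left_mono exp_ge_add_one_self) auto
  also have "\<dots> = exp (- y / 2)" by (simp add: exp_add[symmetric])
  also have "- y / 2 = - (\<Sum>i\<in>J. (\<rho> i)\<^sup>2) / 8"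
    by (simp add: y_def sum_divide_distrib power2_eq_square)
  finally show ?thesis .
qed

section \<open>The median of the rows\<close>

definition rows_pmf :: "nat \<Rightarrow> nat \<Rightarrow> nat \<Rightarrow> (nat \<Rightarrow> nat \<Rightarrow> nat \<times> real) pmf" where
  "rows_pmf R C n = Pi_pmf {..<R} (\<lambda>_. (0, 1)) (\<lambda>_. row_pmf C n)"

definition row_est :: "nat \<Rightarrow> nat \<Rightarrow> (nat \<Rightarrow> real) \<Rightarrow> (nat \<Rightarrow> nat \<Rightarrow> nat \<times> real) \<Rightarrow> nat \<Rightarrow> real" where
  "row_est R n x \<omega> i = median (map (\<lambda>u. x i + row_err n x (\<omega> u) i) [0..<R])"

lemma finite_set_rows_pmf [simp]: "C > 0 \<Longrightarrow> finite (set_pmf (rows_pmf R C n))"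
  unfolding rows_pmf_def by (intro finite_set_Pi_pmf) auto

text \<open>The uniform law on a finite product set is the product of uniform laws; pairing the bin
  and sign of each item is the bijection that exhibits the independent rows.\<close>

lemma hash_pmf_eq_rows:
  assumes "C > 0"
  shows "hash_pmf R C n = map_pmf (\<lambda>\<omega>. (\<lambda>u i. fst (\<omega> u i), \<lambda>u i. snd (\<omega> u i))) (rows_pmf R C n)"
proof -
  define B where "B = PiE_dflt {..<n} (0, 1) (\<lambda>_. {..<C} \<times> {1, -1 :: real})"
  define S where "S = PiE_dflt {..<R} (\<lambda>_. (0, 1)) (\<lambda>_. B)"
  have B: "finite B" "B \<noteq> {}" using assms by (auto simp: B_def)
  have S: "finite S" "S \<noteq> {}" using B by (auto simp: S_def)
  have "row_pmf C n = pmf_of_set B"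
    unfolding row_pmf_def B_def using assms by (subst Pi_pmf_of_set) auto
  then have rows: "rows_pmf R C n = pmf_of_set S"
    unfolding rows_pmf_def S_def using B by (subst Pi_pmf_of_set[symmetric]) auto
  have "bij_betw (\<lambda>\<omega>. (\<lambda>u i. fst (\<omega> u i), \<lambda>u i. snd (\<omega> u i))) S (hash_space R C n)"
  proof (rule bij_betw_byWitness[where f' = "\<lambda>(h, s) u i. (h u i, s u i)"])
    show "(\<lambda>\<omega>. (\<lambda>u i. fst (\<omega> u i), \<lambda>u i. snd (\<omega> u i))) ` S \<subseteq> hash_space R C n"
    proof safe
      fix \<omega> assume \<omega>: "\<omega> \<in> S"
      have rows: "u < R \<Longrightarrow> \<omega> u \<in> B" "\<not> u < R \<Longrightarrow> \<omega> u = (\<lambda>_. (0, 1))" for u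
        using \<omega> by (auto simp: S_def PiE_dflt_def)
      have "u < R \<Longrightarrow> i < n \<Longrightarrow> \<omega> u i \<in> {..<C} \<times> {1, -1}" "\<not> (u < R \<and> i < n) \<Longrightarrow> \<omega> u i = (0, 1)" for u i
        using rows[of u] by (cases "u < R"; fastforce simp: B_def PiE_dflt_def)+
      then show "(\<lambda>u i. fst (\<omega> u i), \<lambda>u i. snd (\<omega> u i)) \<in> hash_space R C n"
        unfolding hash_space_def by (force simp: mem_Times_iff)
    qed
    show "(\<lambda>(h, s) u i. (h u i, s u i)) ` hash_space R C n \<subseteq> S"
      by (auto simp: hash_space_def S_def B_def PiE_dflt_def fun_eq_iff)
  qed auto
  then show ?thesis
    unfolding rows hash_pmf_def using S by (subst map_pmf_of_set_bij_betw) auto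
qed

text \<open>Item \<open>i\<close> contributes exactly \<open>x i\<close> to its own estimate because
  its sign squares to one.\<close>

lemma cs_estimate_eq_row_est:
  assumes "\<omega> \<in> set_pmf (rows_pmf R C n)" "C > 0" "i < n"
  shows "cs_estimate R n (\<lambda>u i. fst (\<omega> u i)) (\<lambda>u i. snd (\<omega> u i)) x i = row_est R n x \<omega> i"
proof -
  have sgn: "snd (\<omega> u i) * snd (\<omega> u i) = 1" if "u < R" for u
  proof -
    have "\<omega> u \<in> set_pmf (row_pmf C n)"
      using assms(1) that by (auto simp: rows_pmf_def set_Pi_pmf PiE_dflt_def)
    then have "\<omega> u i \<in> set_pmf (pmf_of_set ({..<C} \<times> {1, -1 :: real}))"
      using assms(3) by (auto simp: row_pmf_def set_Pi_pmf PiE_dflt_def)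
    then have "\<omega> u i \<in> {..<C} \<times> {1, -1 :: real}"
      using assms(2) by (subst (asm) set_pmf_of_set) auto
    then show ?thesis by auto
  qed
  have "snd (\<omega> u i) * sketch n (\<lambda>u i. fst (\<omega> u i)) (\<lambda>u i. snd (\<omega> u i)) x u (fst (\<omega> u i)) =
      x i + row_err n x (\<omega> u) i" if "u < R" for u
  proof -
    define A where "A = {j. j < n \<and> j \<noteq> i \<and> fst (\<omega> u j) = fst (\<omega> u i)}"
    have "{j. j < n \<and> fst (\<omega> u j) = fst (\<omega> u i)} = insert i A" "finite A" "i \<notin> A"
      using assms(3) by (auto simp: A_def)
    then have "snd (\<omega> u i) * sketch n (\<lambda>u i. fst (\<omega> u i)) (\<lambda>u i. snd (\<omega> u i)) x u (fst (\<omega> u i)) =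
      (snd (\<omega> u i) * snd (\<omega> u i)) * x i + (\<Sum>j\<in>A. snd (\<omega> u i) * snd (\<omega> u j) * x j)"
      by (simp add: sketch_def sum_distrib_left algebra_simps)
    then show ?thesis using sgn[OF that] by (simp add: row_err_def A_def)
  qed
  then show ?thesis
    using assms(3) unfolding cs_estimate_def row_est_def by (auto intro!: arg_cong[of _ _ median])
qed

text \<open>If the median is too large, so are all sorted values from the upper middle position on,
  and these are at least half of the list. The lower side is symmetric.\<close>

lemma median_exceeds:
  assumes "xs \<noteq> []" "\<bar>median xs - c\<bar> > \<tau>"
  shows "\<exists>\<sigma>\<in>{1, -1}. (\<Sum>z\<leftarrow>xs. exceeds \<sigma> \<tau> (z - c)) \<ge> 0"
proof -
  define ys where "ys = sort xs"
  define m where "m = length ys"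
  \<comment> \<open>\<open>l\<close> is the lower and \<open>m div 2\<close> the upper middle
    position; they coincide for odd length and their values always enclose the median.\<close>
  define l where "l = (if odd m then m div 2 else m div 2 - 1)"
  have m: "m > 0" using assms by (simp add: m_def ys_def)
  have sorted: "i \<le> j \<Longrightarrow> j < m \<Longrightarrow> ys ! i \<le> ys ! j" for i j
    by (simp add: ys_def m_def sorted_nth_mono)
  have lm: "l < m" "m div 2 < m" "l \<le> m div 2" using m by (auto simp: l_def)
  have med: "ys ! l \<le> median xs" "median xs \<le> ys ! (m div 2)"
    using sorted[of l "m div 2"] lm by (auto simp: median_def ys_def[symmetric] m_def[symmetric] l_def Let_def)
  have sum: "(\<Sum>z\<leftarrow>xs. f z) = (\<Sum>j<m. f (ys ! j))" for f :: "real \<Rightarrow> real"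
  proof -
    have "(\<Sum>z\<leftarrow>xs. f z) = sum_mset (image_mset f (mset ys))"
      by (simp add: ys_def flip: sum_mset_sum_list)
    also have "\<dots> = (\<Sum>z\<leftarrow>ys. f z)" by (simp flip: sum_mset_sum_list)
    finally show ?thesis by (simp add: sum_list_sum_nth m_def atLeast0LessThan)
  qed
  have split: "(\<Sum>j<m. if j < a then b else - b) = (2 * real a - real m) * b" if "a \<le> m" for a and b :: real
  proof -
    have "{..<m} \<inter> {j. j < a} = {..<a}" "{..<m} \<inter> - {j. j < a} = {a..<m}" using that by auto
    then show ?thesis using that by (simp add: sum.If_cases of_nat_diff algebra_simps)
  qed
  consider "median xs - c > \<tau>" | "median xs - c < - \<tau>" using assms(2) by linarith
  then show ?thesis
  proof cases
    case 1
    have "0 \<le> (\<Sum>j<m. if j < m div 2 then -1 else - (-1 :: real))"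
      using m by (subst split) auto
    also have "\<dots> \<le> (\<Sum>j<m. exceeds 1 \<tau> (ys ! j - c))"
    proof (intro sum_mono)
      fix j assume "j \<in> {..<m}"
      then show "(if j < m div 2 then -1 else - (-1 :: real)) \<le> exceeds 1 \<tau> (ys ! j - c)"
        using sorted[of "m div 2" j] med 1 by (auto simp: exceeds_def)
    qed
    finally show ?thesis by (auto simp: sum)
  next
    case 2
    \<comment> \<open>The positions up to and including \<open>l\<close> number
      \<open>Suc l\<close>, which is at least half of \<open>m\<close> for either parity.\<close>
    have "0 \<le> (\<Sum>j<m. if j < Suc l then 1 else (-1 :: real))"
      using m lm by (subst split) (auto simp: l_def elim!: oddE evenE)
    also have "\<dots> \<le> (\<Sum>j<m. exceeds (-1) \<tau> (ys ! j - c))"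
    proof (intro sum_mono)
      fix j assume "j \<in> {..<m}"
      then show "(if j < Suc l then 1 else (-1 :: real)) \<le> exceeds (-1) \<tau> (ys ! j - c)"
        using sorted[of j l] med lm 2 by (auto simp: exceeds_def)
    qed
    finally show ?thesis by (auto simp: sum)
  qed
qed

text \<open>Equivalently, 1 is at most \<open>exp (z\<^sup>2 - z) * (1 + z)\<close>. For
  \<open>z \<ge> 0\<close> the tangent bound on the exponential suffices, as the product becomes
  \<open>1 + z ^ 3\<close>; for negative \<open>z\<close> this is below one and the quadratic Taylor
  bound takes over.\<close>

lemma exp_diff_square_le:
  fixes z :: real
  assumes "\<bar>z\<bar> \<le> 1/2"
  shows "exp (z - z\<^sup>2) \<le> 1 + z"
proof -
  have "1 \<le> exp (z\<^sup>2 - z) * (1 + z)"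
  proof (cases "z \<ge> 0")
    case True
    have "(1 + (z\<^sup>2 - z)) * (1 + z) = 1 + z ^ 3" by (simp add: power2_eq_square power3_eq_cube algebra_simps)
    then have "1 \<le> (1 + (z\<^sup>2 - z)) * (1 + z)" using True by simp
    also have "\<dots> \<le> exp (z\<^sup>2 - z) * (1 + z)"
      using True exp_ge_add_one_self[of "z\<^sup>2 - z"] by (intro mult_right_mono) auto
    finally show ?thesis .
  next
    case False
    define y where "y = - z"
    have y: "0 \<le> y" "y \<le> 1/2" "z = - y" using False assms by (auto simp: y_def)
    \<comment> \<open>The excess over one has the factor \<open>y\<^sup>2\<close>. The other factor
      is nonnegative because \<open>1 - y * y \<ge> 3/4\<close> reduces it to a linear inequality in
      \<open>y\<close>.\<close>
    have "y * y \<le> 1/2 * (1/2)" using y by (intro mult_mono) auto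
    then have "3/4 * (1 + y) \<le> (1 - y * y) * (1 + y)" using y by (intro mult_right_mono) auto
    then have "0 \<le> (1 - y * y) * (1 + y) / 2 - y" using y by (simp add: field_simps)
    then have "0 \<le> y\<^sup>2 * ((1 - y * y) * (1 + y) / 2 - y)" by (intro mult_nonneg_nonneg) auto
    also have "\<dots> = (1 + (z\<^sup>2 - z) + (z\<^sup>2 - z)\<^sup>2 / 2) * (1 + z) - 1"
      unfolding y(3) by (simp add: power2_eq_square field_simps)
    finally have "1 \<le> (1 + (z\<^sup>2 - z) + (z\<^sup>2 - z)\<^sup>2 / 2) * (1 + z)" by simp
    also have "\<dots> \<le> exp (z\<^sup>2 - z) * (1 + z)"
      using y by (intro mult_right_mono exp_lower_Taylor_quadratic) auto
    finally show ?thesis .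
  qed
  then have "exp (z - z\<^sup>2) * 1 \<le> exp (z - z\<^sup>2) * (exp (z\<^sup>2 - z) * (1 + z))" by (intro mult_left_mono) auto
  also have "\<dots> = 1 + z" by (simp add: mult.assoc[symmetric] exp_add[symmetric])
  finally show ?thesis by simp
qed

text \<open>A nonnegative sum of signs is certified by a product that is multilinear in the signs,
  the form in which the one-row estimates are stated. Compared with an exponential of the sum this
  costs \<open>\<theta>\<^sup>2\<close> per sign in the exponent.\<close>

lemma prod_one_plus_sign_ge:
  fixes Y :: "'a \<Rightarrow> real"
  assumes "finite U" "0 \<le> \<theta>" "\<theta> \<le> 1/2" "\<And>u. u \<in> U \<Longrightarrow> \<bar>Y u\<bar> = 1" "(\<Sum>u\<in>U. Y u) \<ge> 0"
  shows "1 \<le> exp (real (card U) * \<theta>\<^sup>2) * (\<Prod>u\<in>U. 1 + \<theta> * Y u)"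
proof -
  have "1 \<le> exp (\<theta> * (\<Sum>u\<in>U. Y u))" using assms by simp
  also have "\<theta> * (\<Sum>u\<in>U. Y u) = real (card U) * \<theta>\<^sup>2 + (\<Sum>u\<in>U. \<theta> * Y u - (\<theta> * Y u)\<^sup>2)"
  proof -
    have "(Y u)\<^sup>2 = 1" if "u \<in> U" for u using assms(4)[OF that] by (metis power2_abs power_one)
    then show ?thesis by (simp add: sum_subtractf sum_distrib_left power_mult_distrib)
  qed
  also have "exp \<dots> = exp (real (card U) * \<theta>\<^sup>2) * (\<Prod>u\<in>U. exp (\<theta> * Y u - (\<theta> * Y u)\<^sup>2))"
    using assms(1) by (simp add: exp_add exp_sum)
  also have "\<dots> \<le> exp (real (card U) * \<theta>\<^sup>2) * (\<Prod>u\<in>U. 1 + \<theta> * Y u)"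
    using assms by (intro mult_left_mono prod_mono conjI exp_diff_square_le) (auto simp: abs_mult)
  finally show ?thesis .
qed

text \<open>Each erring median has a direction in which at least half of the rows exceed. Sum over
  the \<open>2 ^ card J\<close> choices of directions and apply Markov to the product certificates.
  Per row and index the certificate costs \<open>(\<rho> i)\<^sup>2 / 16\<close> and the row bound
  gains \<open>(\<rho> i)\<^sup>2 / 8\<close>; with \<open>\<rho> i = t i / 20\<close> the net gain
  is \<open>(t i)\<^sup>2 / 6400\<close>.\<close>

lemma joint_tail:
  fixes t x :: "nat \<Rightarrow> real"
  assumes J: "J \<subseteq> {..<n}" "card J \<le> q" "2 * q \<le> C" and k: "8 * k \<le> C" "k > 0" and R: "R > 0"
    and t: "\<And>i. i \<in> J \<Longrightarrow> 0 \<le> t i \<and> t i \<le> 1"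
    and q: "(real q)\<^sup>2 / real C * (1 + real q * exp (real q / 80)) \<le> exp (- real q / 1600) / 2"
  defines "s \<equiv> l2norm n (tail_vec k x) / sqrt (real C)"
  shows "measure_pmf.prob (rows_pmf R C n) {\<omega>. \<forall>i\<in>J. \<bar>row_est R n x \<omega> i - x i\<bar> > t i * s}
    \<le> 2 ^ card J * exp (- real R * (\<Sum>i\<in>J. (t i)\<^sup>2) / 6400)"
proof -
  let ?P = "rows_pmf R C n"
  have C: "C > 0" using k by simp
  have finJ: "finite J" using J finite_subset by blast
  have finP: "finite (set_pmf ?P)" using C by simp
  have s: "s \<ge> 0" by (simp add: s_def l2norm_def sum_nonneg)
  define \<rho> where "\<rho> = (\<lambda>i. t i / 20)"
  define Y :: "(nat \<Rightarrow> real) \<Rightarrow> (nat \<Rightarrow> nat \<Rightarrow> nat \<times> real) \<Rightarrow> nat \<Rightarrow> nat \<Rightarrow> real"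
    where "Y = (\<lambda>\<sigma> \<omega> i u. exceeds (\<sigma> i) (t i * s) (row_err n x (\<omega> u) i))"
  define \<Sigma> where "\<Sigma> = PiE J (\<lambda>_. {1, -1 :: real})"
  define F where "F = (\<lambda>\<sigma> \<omega>. \<Prod>i\<in>J. exp (real R * (\<rho> i / 4)\<^sup>2) * (\<Prod>u<R. 1 + \<rho> i / 4 * Y \<sigma> \<omega> i u))"
  have fin\<Sigma>: "finite \<Sigma>" unfolding \<Sigma>_def using finJ by (intro finite_PiE) auto
  have \<rho>: "0 \<le> \<rho> i \<and> \<rho> i \<le> 1/20" if "i \<in> J" for i using t[OF that] by (simp add: \<rho>_def)
  have nonneg: "0 \<le> 1 + \<rho> i / 4 * exceeds a b e" if "i \<in> J" for i a b e
    using \<rho>[OF that] by (auto simp: exceeds_def)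
  have F0: "0 \<le> F \<sigma> \<omega>" for \<sigma> \<omega>
    unfolding F_def Y_def using nonneg by (intro prod_nonneg mult_nonneg_nonneg) auto
  have ball: "\<rho> i \<le> E (Pi_pmf M 0 (\<lambda>_. lazy_sign (1 / real m))) (\<lambda>w. of_bool (\<bar>\<Sum>j\<in>M. w j * x j\<bar> \<le> t i * s))"
    if "i \<in> J" "M \<subseteq> {..<n}" "C - card J < m" for i M and m :: nat
  proof -
    \<comment> \<open>At every stage at least half of the bins remain. Hence the \<open>k\<close>
      head items, taken as the heavy set, meet the bound 1/4, and the variance of the tail in one
      bin is at most \<open>s\<^sup>2\<close>.\<close>
    have m: "2 * m \<ge> C" "m \<ge> 4 * k" "m \<ge> 2" using that J k by auto
    have "2 / real C \<ge> 1 / real m" using m C by (simp add: field_simps)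
    have finM: "finite M" using that finite_subset by blast
    have tail: "(\<Sum>j\<in>M - {..<k}. (x j)\<^sup>2) \<le> (l2norm n (tail_vec k x))\<^sup>2"
    proof -
      have "(l2norm n (tail_vec k x))\<^sup>2 = (\<Sum>j<n. (tail_vec k x j)\<^sup>2)"
        by (simp add: l2norm_def sum_nonneg)
      moreover have "(\<Sum>j\<in>M - {..<k}. (x j)\<^sup>2) = (\<Sum>j\<in>M - {..<k}. (tail_vec k x j)\<^sup>2)"
        by (intro sum.cong) (auto simp: tail_vec_def)
      moreover have "\<dots> \<le> (\<Sum>j<n. (tail_vec k x j)\<^sup>2)"
        using that by (intro sum_mono2) auto
      ultimately show ?thesis by simp
    qed
    have "t i / 20 \<le> E (Pi_pmf M 0 (\<lambda>_. lazy_sign (1 / real m))) (\<lambda>w. of_bool (\<bar>\<Sum>j\<in>M. w j * x j\<bar> \<le> t i * s))"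
    proof (rule small_ball[where H = "{..<k}"])
      show "1 / real m \<le> 1/2" using m by (simp add: field_simps)
      show "1 / real m * real (card {..<k}) \<le> 1/4" using m by (simp add: field_simps)
      have "1 / real m / 2 * (\<Sum>j\<in>M - {..<k}. (x j)\<^sup>2) \<le> 2 / real C / 2 * (l2norm n (tail_vec k x))\<^sup>2"
        using \<open>2 / real C \<ge> 1 / real m\<close> tail by (intro mult_mono divide_right_mono sum_nonneg) auto
      then show "1 / real m / 2 * (\<Sum>j\<in>M - {..<k}. (x j)\<^sup>2) \<le> s\<^sup>2"
        by (simp add: s_def power_divide)
    qed (use finM s t[OF that(1)] in auto)
    then show ?thesis by (simp add: \<rho>_def)
  qed
  have "measure_pmf.prob ?P {\<omega>. \<forall>i\<in>J. \<bar>row_est R n x \<omega> i - x i\<bar> > t i * s} \<le> E ?P (\<lambda>\<omega>. \<Sum>\<sigma>\<in>\<Sigma>. F \<sigma> \<omega>)"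
  proof (intro prob_le_E finP)
    fix \<omega> assume "\<omega> \<in> {\<omega>. \<forall>i\<in>J. \<bar>row_est R n x \<omega> i - x i\<bar> > t i * s}"
    then have "\<exists>\<sigma>\<in>{1, -1}. (\<Sum>z\<leftarrow>map (\<lambda>u. x i + row_err n x (\<omega> u) i) [0..<R]. exceeds \<sigma> (t i * s) (z - x i)) \<ge> 0" if "i \<in> J" for i
      using that R unfolding row_est_def by (intro median_exceeds) auto
    then have "\<exists>\<sigma>\<in>{1, -1}. (\<Sum>u<R. exceeds \<sigma> (t i * s) (row_err n x (\<omega> u) i)) \<ge> 0" if "i \<in> J" for i
      using that by (simp add: interv_sum_list_conv_sum_set_nat atLeast0LessThan comp_def)
    then obtain \<sigma> where \<sigma>: "\<And>i. i \<in> J \<Longrightarrow> \<sigma> i \<in> {1, -1} \<and> (\<Sum>u<R. exceeds (\<sigma> i) (t i * s) (row_err n x (\<omega> u) i)) \<ge> 0"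
      by metis
    define \<sigma>' where "\<sigma>' = restrict \<sigma> J"
    have "\<sigma>' \<in> \<Sigma>" using \<sigma> by (auto simp: \<Sigma>_def \<sigma>'_def)
    have "1 \<le> F \<sigma>' \<omega>"
      unfolding F_def
    proof (intro prod_ge_1)
      fix i assume i: "i \<in> J"
      have "1 \<le> exp (real (card {..<R}) * (\<rho> i / 4)\<^sup>2) * (\<Prod>u<R. 1 + \<rho> i / 4 * Y \<sigma>' \<omega> i u)"
        using \<sigma>[OF i] \<rho>[OF i] i by (intro prod_one_plus_sign_ge) (auto simp: Y_def \<sigma>'_def)
      then show "1 \<le> exp (real R * (\<rho> i / 4)\<^sup>2) * (\<Prod>u<R. 1 + \<rho> i / 4 * Y \<sigma>' \<omega> i u)" by simp
    qed
    also have "\<dots> \<le> (\<Sum>\<sigma>\<in>\<Sigma>. F \<sigma> \<omega>)"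
      using \<open>\<sigma>' \<in> \<Sigma>\<close> fin\<Sigma> F0 by (intro member_le_sum) auto
    finally show "1 \<le> (\<Sum>\<sigma>\<in>\<Sigma>. F \<sigma> \<omega>)" .
  qed (auto intro: sum_nonneg F0)
  also have "\<dots> = (\<Sum>\<sigma>\<in>\<Sigma>. E ?P (F \<sigma>))" by (rule E_finite_sum[OF finP])
  also have "\<dots> \<le> (\<Sum>\<sigma>\<in>\<Sigma>. exp (- real R * (\<Sum>i\<in>J. (t i)\<^sup>2) / 6400))"
  proof (intro sum_mono)
    fix \<sigma> assume \<sigma>: "\<sigma> \<in> \<Sigma>"
    define G where "G = (\<lambda>g. \<Prod>i\<in>J. 1 + \<rho> i / 4 * exceeds (\<sigma> i) (t i * s) (row_err n x g i))"
    have "F \<sigma> \<omega> = exp (real R * (\<Sum>i\<in>J. (\<rho> i / 4)\<^sup>2)) * (\<Prod>u<R. G (\<omega> u))" for \<omega>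
    proof -
      \<comment> \<open>Regrouping by rows turns the certificate into a product of independent
        factors.\<close>
      have "(\<Prod>i\<in>J. \<Prod>u<R. 1 + \<rho> i / 4 * Y \<sigma> \<omega> i u) = (\<Prod>u<R. G (\<omega> u))"
        unfolding G_def Y_def by (rule prod.swap)
      then show ?thesis
        unfolding F_def prod.distrib using finJ by (simp add: exp_sum sum_distrib_left)
    qed
    then have "F \<sigma> = (\<lambda>\<omega>. exp (real R * (\<Sum>i\<in>J. (\<rho> i / 4)\<^sup>2)) * (\<Prod>u<R. G (\<omega> u)))" by (rule ext)
    then have "E ?P (F \<sigma>) = exp (real R * (\<Sum>i\<in>J. (\<rho> i / 4)\<^sup>2)) * E ?P (\<lambda>\<omega>. \<Prod>u<R. G (\<omega> u))" by simp
    also have "E ?P (\<lambda>\<omega>. \<Prod>u<R. G (\<omega> u)) = (\<Prod>u<R. E (row_pmf C n) G)"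
      unfolding rows_pmf_def using nonneg C
      by (intro expectation_prod_Pi_pmf integrable_measure_pmf_finite) (auto simp: G_def intro!: prod_nonneg)
    also have "\<dots> \<le> (\<Prod>u<R. exp (- (\<Sum>i\<in>J. (\<rho> i)\<^sup>2) / 8))"
    proof (intro prod_mono conjI)
      show "0 \<le> E (row_pmf C n) G"
        using nonneg by (intro Bochner_Integration.integral_nonneg) (auto simp: G_def intro!: prod_nonneg)
      show "E (row_pmf C n) G \<le> exp (- (\<Sum>i\<in>J. (\<rho> i)\<^sup>2) / 8)"
        unfolding G_def
      proof (rule E_row_exp_bound)
        show "q < C" using J k by auto
        show "\<sigma> i = 1 \<or> \<sigma> i = -1" if "i \<in> J" for i using \<sigma> that by (auto simp: \<Sigma>_def)
      qed (use J \<rho> ball q s t in auto)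
    qed
    also have "exp (real R * (\<Sum>i\<in>J. (\<rho> i / 4)\<^sup>2)) * (\<Prod>u<R. exp (- (\<Sum>i\<in>J. (\<rho> i)\<^sup>2) / 8)) =
        exp (real R * (\<Sum>i\<in>J. (\<rho> i / 4)\<^sup>2) + real R * (- (\<Sum>i\<in>J. (\<rho> i)\<^sup>2) / 8))"
      by (simp only: exp_add exp_of_nat_mult prod_constant card_lessThan)
    also have "real R * (\<Sum>i\<in>J. (\<rho> i / 4)\<^sup>2) + real R * (- (\<Sum>i\<in>J. (\<rho> i)\<^sup>2) / 8) = - real R * (\<Sum>i\<in>J. (t i)\<^sup>2) / 6400"
      by (simp add: \<rho>_def power_divide sum_divide_distrib[symmetric])
    finally show "E ?P (F \<sigma>) \<le> exp (- real R * (\<Sum>i\<in>J. (t i)\<^sup>2) / 6400)" by simp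
  qed
  also have "\<dots> = real (card \<Sigma>) * exp (- real R * (\<Sum>i\<in>J. (t i)\<^sup>2) / 6400)" by simp
  also have "card \<Sigma> = 2 ^ card J" unfolding \<Sigma>_def using finJ by (simp add: card_PiE numeral_2_eq_2)
  finally show ?thesis by simp
qed

section \<open>Moments of the squared errors\<close>

lemma prob_eq_E: "measure_pmf.prob p {x. P x} = E p (\<lambda>x. of_bool (P x))"
proof -
  have "(\<lambda>x. of_bool (P x) :: real) = indicator {x. P x}" by (auto simp: indicator_def)
  then show ?thesis by simp
qed

section \<open>Sums of products over distinct indices\<close>

definition distinct_lists :: "'a set \<Rightarrow> nat \<Rightarrow> 'a list set" where
  "distinct_lists A q = {is. set is \<subseteq> A \<and> distinct is \<and> length is = q}"

lemma distinct_lists_0 [simp]: "distinct_lists A 0 = {[]}"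
  by (auto simp: distinct_lists_def)

lemma finite_distinct_lists: "finite A \<Longrightarrow> finite (distinct_lists A q)"
  by (rule finite_subset[OF _ finite_lists_length_eq[of A q]]) (auto simp: distinct_lists_def)

lemma card_distinct_lists_le: "finite A \<Longrightarrow> card (distinct_lists A q) \<le> card A ^ q"
  using card_mono[OF finite_lists_length_eq[of A q], of "distinct_lists A q"]
  by (auto simp: distinct_lists_def card_lists_length_eq)

text \<open>Extend the lists one index at a time: the indices already chosen carry at most
  \<open>S\<close> of a total of at least \<open>2 * S\<close>, so the free ones still contribute
  \<open>S\<close>. Ordered lists keep factorials out of the bound.\<close>

lemma sum_distinct_lists_ge:
  fixes U :: "'a \<Rightarrow> real"
  assumes "finite A" "\<And>i. i \<in> A \<Longrightarrow> 0 \<le> U i \<and> U i \<le> B" "2 * S \<le> (\<Sum>i\<in>A. U i)"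
    "real q * B \<le> S" "0 \<le> S" "0 \<le> B"
  shows "S ^ q \<le> (\<Sum>is\<in>distinct_lists A q. \<Prod>i\<in>set is. U i)"
  using assms(4)
proof (induction q)
  case (Suc q)
  have eq: "distinct_lists A (Suc q) = (\<lambda>(is, i). i # is) ` Sigma (distinct_lists A q) (\<lambda>is. A - set is)"
    by (force simp: distinct_lists_def length_Suc_conv image_iff)
  have inj: "inj_on (\<lambda>(is, i). i # is) (Sigma (distinct_lists A q) (\<lambda>is. A - set is))"
    by (auto simp: inj_on_def)
  have qB: "real q * B \<le> real (Suc q) * B" using assms by (intro mult_right_mono) auto
  have "S ^ q \<le> (\<Sum>is\<in>distinct_lists A q. \<Prod>i\<in>set is. U i)"
    using Suc qB by linarith
  then have "S ^ Suc q \<le> (\<Sum>is\<in>distinct_lists A q. \<Prod>i\<in>set is. U i) * S"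
    unfolding power_Suc2 using assms(5) by (rule mult_right_mono)
  also have "\<dots> = (\<Sum>is\<in>distinct_lists A q. (\<Prod>i\<in>set is. U i) * S)" by (rule sum_distrib_right)
  also have "\<dots> \<le> (\<Sum>is\<in>distinct_lists A q. (\<Prod>i\<in>set is. U i) * (\<Sum>i\<in>A - set is. U i))"
  proof (intro sum_mono mult_left_mono prod_nonneg)
    fix "is" assume "is": "is \<in> distinct_lists A q"
    then have sub: "set is \<subseteq> A" "card (set is) = q" by (auto simp: distinct_lists_def distinct_card)
    then have "(\<Sum>i\<in>set is. U i) \<le> real q * B"
      using assms sum_bounded_above[of "set is" U B] by auto
    then have "(\<Sum>i\<in>set is. U i) \<le> S" using Suc.prems qB by linarith
    moreover have "(\<Sum>i\<in>A. U i) = (\<Sum>i\<in>A - set is. U i) + (\<Sum>i\<in>set is. U i)"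
      using assms(1) sub by (intro sum.subset_diff) auto
    ultimately show "S \<le> (\<Sum>i\<in>A - set is. U i)" using assms(3) by linarith
    show "\<And>i. i \<in> set is \<Longrightarrow> 0 \<le> U i" using sub assms by auto
  qed
  also have "\<dots> = (\<Sum>(is, i)\<in>Sigma (distinct_lists A q) (\<lambda>is. A - set is). (\<Prod>i\<in>set is. U i) * U i)"
    using assms(1) by (simp add: sum_distrib_left sum.Sigma finite_distinct_lists)
  also have "\<dots> = (\<Sum>is\<in>distinct_lists A (Suc q). \<Prod>i\<in>set is. U i)"
    unfolding eq sum.reindex[OF inj]
  proof (intro sum.cong refl)
    fix p assume "p \<in> Sigma (distinct_lists A q) (\<lambda>is. A - set is)"
    then obtain "is" i where p: "p = (is, i)" "i \<notin> set is" by auto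
    show "(case p of (is, i) \<Rightarrow> (\<Prod>i\<in>set is. U i) * U i) = ((\<lambda>is. \<Prod>i\<in>set is. U i) \<circ> (\<lambda>(is, i). i # is)) p"
      unfolding p(1) comp_def prod.case list.set prod.insert[OF finite_set p(2)] by (rule mult.commute)
  qed
  finally show ?case .
qed simp

text \<open>For \<open>z \<ge> 0\<close> this is the minimum of \<open>R\<close> and the ceiling of
  \<open>z\<close>, written as a sum of threshold indicators so that joint tail bounds control
  products of such counts.\<close>

definition level_count :: "nat \<Rightarrow> real \<Rightarrow> real" where
  "level_count R z = (\<Sum>m<R. of_bool (real m < z))"

lemma level_count_ge: "z \<le> real R \<Longrightarrow> z \<le> level_count R z"
proof -
  assume z: "z \<le> real R"
  have "{m. m < R \<and> real m < z} \<supseteq> {..<nat \<lceil>z\<rceil>}"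
    using z by (auto simp: less_ceiling_iff zless_nat_eq_int_zless)
  then have "card {..<nat \<lceil>z\<rceil>} \<le> card {m. m < R \<and> real m < z}" by (intro card_mono) auto
  moreover have "level_count R z = real (card {m. m < R \<and> real m < z})"
    unfolding level_count_def by (simp add: Int_def)
  ultimately show ?thesis by simp
qed

text \<open>Either \<open>z\<close> itself or the cap \<open>R\<close> limits the count; the added
  one pays for rounding up.\<close>

lemma level_count_le: 
  assumes "0 \<le> L" "z \<le> L \<or> real R \<le> L"
  shows "level_count R z \<le> L + 1"
proof -
  have eq: "level_count R z = real (card {m. m < R \<and> real m < z})"
    unfolding level_count_def by (simp add: Int_def)
  have "{m. m < R \<and> real m < z} \<subseteq> {..<nat \<lceil>L\<rceil>}"
    using assms by (auto simp: less_ceiling_iff zless_nat_eq_int_zless)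
  then have "card {m. m < R \<and> real m < z} \<le> card {..<nat \<lceil>L\<rceil>}" by (intro card_mono) auto
  then have "level_count R z \<le> real (nat \<lceil>L\<rceil>)" unfolding eq by simp
  also have "\<dots> \<le> L + 1" using assms by linarith
  finally show ?thesis .
qed

lemma sum_exp_neg_le:
  assumes "\<beta> > (0 :: real)"
  shows "(\<Sum>m<R. 2 * exp (- \<beta> * real m)) \<le> 2 / (1 - exp (- \<beta>))"
proof -
  have "(\<Sum>m<R. 2 * exp (- \<beta> * real m)) = 2 * (\<Sum>m<R. exp (- \<beta>) ^ m)"
    by (simp add: sum_distrib_left exp_of_nat_mult[symmetric] mult.commute)
  also have "\<dots> \<le> 2 * (1 / (1 - exp (- \<beta>)))"
  proof (intro mult_left_mono)
    have "(\<Sum>m<R. exp (- \<beta>) ^ m) \<le> (\<Sum>m. exp (- \<beta>) ^ m)"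
      using assms by (intro sum_le_suminf summable_geometric) auto
    then show "(\<Sum>m<R. exp (- \<beta>) ^ m) \<le> 1 / (1 - exp (- \<beta>))"
      using assms by (simp add: suminf_geometric)
  qed auto
  finally show ?thesis by simp
qed

text \<open>Expanding the product gives one joint tail event per choice of levels. Level
  \<open>m\<close> corresponds to the threshold parameter \<open>t = sqrt (m / R)\<close>, so
  \<open>R * t\<^sup>2 = m\<close> and the bound factors into one geometric series per index. Levels
  stay below \<open>R\<close>, hence \<open>t \<le> 1\<close>.\<close>

lemma E_prod_level_count:
  fixes x :: "nat \<Rightarrow> real"
  assumes J: "J \<subseteq> {..<n}" "card J \<le> q" "2 * q \<le> C" and k: "8 * k \<le> C" "k > 0" and R: "R > 0"
    and q: "(real q)\<^sup>2 / real C * (1 + real q * exp (real q / 80)) \<le> exp (- real q / 1600) / 2"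
  defines "s \<equiv> l2norm n (tail_vec k x) / sqrt (real C)"
  assumes s: "s > 0"
  shows "E (rows_pmf R C n) (\<lambda>\<omega>. \<Prod>i\<in>J. level_count R (real R * (row_est R n x \<omega> i - x i)\<^sup>2 / s\<^sup>2))
    \<le> (2 / (1 - exp (- 1 / 6400))) ^ card J"
proof -
  let ?P = "rows_pmf R C n"
  have C: "C > 0" using k by simp
  have finJ: "finite J" using J finite_subset by blast
  have finP: "finite (set_pmf ?P)" using C by simp
  define M where "M = PiE J (\<lambda>_. {..<R})"
  have ofb: "(\<Prod>i\<in>J. of_bool (Q i)) = (of_bool (\<forall>i\<in>J. Q i) :: real)" for Q
    using finJ by (induction J rule: finite_induct) auto
  have level: "real m < real R * e\<^sup>2 / s\<^sup>2 \<longleftrightarrow> sqrt (real m / real R) * s < \<bar>e\<bar>" for m e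
  proof -
    have "sqrt (real m / real R) * s < \<bar>e\<bar> \<longleftrightarrow> (sqrt (real m / real R) * s)\<^sup>2 < \<bar>e\<bar>\<^sup>2"
      unfolding not_le[symmetric] using s by (subst power_mono_iff) auto
    also have "\<dots> \<longleftrightarrow> real m < real R * e\<^sup>2 / s\<^sup>2"
      using s R by (simp add: power_mult_distrib field_simps)
    finally show ?thesis by simp
  qed
  have "E ?P (\<lambda>\<omega>. \<Prod>i\<in>J. level_count R (real R * (row_est R n x \<omega> i - x i)\<^sup>2 / s\<^sup>2)) =
      E ?P (\<lambda>\<omega>. \<Sum>\<mu>\<in>M. of_bool (\<forall>i\<in>J. \<bar>row_est R n x \<omega> i - x i\<bar> > sqrt (real (\<mu> i) / real R) * s))"
  proof (intro E_cong)
    fix \<omega>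
    have "(\<Prod>i\<in>J. level_count R (real R * (row_est R n x \<omega> i - x i)\<^sup>2 / s\<^sup>2)) =
      (\<Sum>\<mu>\<in>M. \<Prod>i\<in>J. of_bool (\<bar>row_est R n x \<omega> i - x i\<bar> > sqrt (real (\<mu> i) / real R) * s))"
      unfolding level_count_def level M_def using finJ by (subst prod_sum_PiE) auto
    also have "\<dots> = (\<Sum>\<mu>\<in>M. of_bool (\<forall>i\<in>J. \<bar>row_est R n x \<omega> i - x i\<bar> > sqrt (real (\<mu> i) / real R) * s))"
      by (simp only: ofb)
    finally show "(\<Prod>i\<in>J. level_count R (real R * (row_est R n x \<omega> i - x i)\<^sup>2 / s\<^sup>2)) = \<dots>" .
  qed
  also have "\<dots> = (\<Sum>\<mu>\<in>M. measure_pmf.prob ?P {\<omega>. \<forall>i\<in>J. \<bar>row_est R n x \<omega> i - x i\<bar> > sqrt (real (\<mu> i) / real R) * s})"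
    by (simp only: E_finite_sum[OF finP] prob_eq_E)
  also have "\<dots> \<le> (\<Sum>\<mu>\<in>M. \<Prod>i\<in>J. 2 * exp (- (1 / 6400) * real (\<mu> i)))"
  proof (intro sum_mono)
    fix \<mu> assume "\<mu> \<in> M"
    then have \<mu>: "\<mu> i < R" if "i \<in> J" for i using that by (auto simp: M_def)
    have "measure_pmf.prob ?P {\<omega>. \<forall>i\<in>J. \<bar>row_est R n x \<omega> i - x i\<bar> > sqrt (real (\<mu> i) / real R) * s} \<le>
        2 ^ card J * exp (- real R * (\<Sum>i\<in>J. (sqrt (real (\<mu> i) / real R))\<^sup>2) / 6400)"
      unfolding s_def
    proof (rule joint_tail)
      show "0 \<le> sqrt (real (\<mu> i) / real R) \<and> sqrt (real (\<mu> i) / real R) \<le> 1" if "i \<in> J" for i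
        using \<mu>[OF that] R by (auto simp: field_simps)
    qed (use J k R q in auto)
    also have "- real R * (\<Sum>i\<in>J. (sqrt (real (\<mu> i) / real R))\<^sup>2) / 6400 = (\<Sum>i\<in>J. - (1 / 6400) * real (\<mu> i))"
      using R by (simp add: sum_distrib_left[symmetric] sum_divide_distrib[symmetric] sum_negf)
    also have "2 ^ card J * exp \<dots> = (\<Prod>i\<in>J. 2 * exp (- (1 / 6400) * real (\<mu> i)))"
      using finJ by (simp add: exp_sum prod.distrib)
    finally show "measure_pmf.prob ?P {\<omega>. \<forall>i\<in>J. \<bar>row_est R n x \<omega> i - x i\<bar> > sqrt (real (\<mu> i) / real R) * s} \<le>
      (\<Prod>i\<in>J. 2 * exp (- (1 / 6400) * real (\<mu> i)))" .
  qed
  also have "\<dots> = (\<Prod>i\<in>J. \<Sum>m<R. 2 * exp (- (1 / 6400) * real m))"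
    unfolding M_def using finJ by (subst prod_sum_PiE) auto
  also have "\<dots> \<le> (\<Prod>i\<in>J. 2 / (1 - exp (- (1 / 6400))))"
    by (intro prod_mono conjI sum_exp_neg_le sum_nonneg) auto
  finally show ?thesis by simp
qed

section \<open>Top-k error\<close>

text \<open>A value of size at most \<open>B\<close> is beaten by the first \<open>k\<close> entries
  and never selected. A value above \<open>B\<close> lies in the common prefix, and so does every
  entry that beats it, so its rank is the same in both vectors.\<close>

lemma Hk_cong:
  assumes agree: "\<And>i. i < m \<Longrightarrow> z i = z' i" and "k \<le> m" "k \<le> n"
    and big: "\<And>i. i < k \<Longrightarrow> B < \<bar>z i\<bar>"
    and small: "\<And>i. m \<le> i \<Longrightarrow> i < n \<Longrightarrow> \<bar>z i\<bar> \<le> B \<and> \<bar>z' i\<bar> \<le> B"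
  shows "Hk n k z = Hk n k z'"
proof -
  define W where "W = (\<lambda>z :: nat \<Rightarrow> real. \<lambda>i. {j. j < n \<and> (\<bar>z j\<bar> > \<bar>z i\<bar> \<or> (\<bar>z j\<bar> = \<bar>z i\<bar> \<and> j < i))})"
  have topk: "topk n k z = {i. i < n \<and> card (W z i) < k}" for z by (simp add: topk_def W_def)
  have out: "\<not> card (W y i) < k" if "\<And>j. j < k \<Longrightarrow> \<bar>y j\<bar> > B" "\<bar>y i\<bar> \<le> B" for y i
  proof -
    have "{..<k} \<subseteq> W y i" using that assms(3) by (force simp: W_def)
    then have "card {..<k} \<le> card (W y i)" by (intro card_mono) (auto simp: W_def)
    then show ?thesis by simp
  qed
  have big': "B < \<bar>z' j\<bar>" if "j < k" for j using big[OF that] agree[of j] that assms(2) by simp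
  have eq: "card (W z i) < k \<longleftrightarrow> card (W z' i) < k" if "i < n" for i
  proof (cases "\<bar>z i\<bar> \<le> B \<or> \<bar>z' i\<bar> \<le> B")
    case True
    have "\<bar>z i\<bar> \<le> B" "\<bar>z' i\<bar> \<le> B"
      using True agree[of i] small[of i] that by (cases "i < m"; auto)+
    then show ?thesis using out[of z i] out[of z' i] big big' by blast
  next
    case False
    then have i: "i < m" using small[of i] that by (meson not_le)
    have "W z i = W z' i"
    proof (intro set_eqI)
      fix j
      show "j \<in> W z i \<longleftrightarrow> j \<in> W z' i"
        using agree[OF i] agree[of j] small[of j] False by (cases "j < m") (auto simp: W_def)
    qed
    then show ?thesis by simp
  qed
  show ?thesis
  proof (intro ext)
    fix i
    show "Hk n k z i = Hk n k z' i"
    proof (cases "i < m")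
      case True
      then show ?thesis using eq[of i] agree[of i] by (auto simp: Hk_def topk)
    next
      case False
      then have "i \<notin> topk n k z" "i \<notin> topk n k z'"
        using out[of z i] out[of z' i] big big' small[of i] by (auto simp: topk)
      then show ?thesis by (simp add: Hk_def)
    qed
  qed
qed

lemma Ek_square_le:
  assumes "\<And>i. i \<ge> n \<Longrightarrow> x' i = 0" "Hk n k x' = Hk n k xh"
  shows "(Ek n k x xh)\<^sup>2 \<le> (\<Sum>i<n. (x i - x' i)\<^sup>2)"
proof -
  let ?S = "{l2norm n (\<lambda>i. x i - x' i) | x'. (\<forall>i\<ge>n. x' i = 0) \<and> Hk n k x' = Hk n k xh}"
  have nn: "0 \<le> l2norm n z" for z by (simp add: l2norm_def sum_nonneg)
  have mem: "l2norm n (\<lambda>i. x i - x' i) \<in> ?S" using assms by blast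
  have "Ek n k x xh \<le> l2norm n (\<lambda>i. x i - x' i)"
    unfolding Ek_def using nn by (intro cInf_lower[OF mem] bdd_belowI[of _ 0]) auto
  moreover have "0 \<le> Ek n k x xh"
    unfolding Ek_def using mem nn by (intro cInf_greatest) auto
  ultimately have "(Ek n k x xh)\<^sup>2 \<le> (l2norm n (\<lambda>i. x i - x' i))\<^sup>2" by (intro power_mono)
  then show ?thesis by (simp add: l2norm_def sum_nonneg)
qed

text \<open>The competitor in \<open>Ek\<close> must agree with the estimate only after restriction
  to the top \<open>k\<close>. If these lie among the first \<open>2 * k\<close> coordinates, it may
  take the true values beyond, where it then has no error.\<close>

lemma Ek_square_le_head:
  assumes k: "0 < k" "2 * k \<le> n"
    and sorted: "\<And>i j. i \<le> j \<Longrightarrow> j < n \<Longrightarrow> \<bar>x j\<bar> \<le> \<bar>x i\<bar>"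
    and xh: "\<And>i. i \<ge> n \<Longrightarrow> xh i = 0" "\<And>i. i < n \<Longrightarrow> \<bar>xh i - x i\<bar> \<le> s"
    and gap: "\<bar>x (k - 1)\<bar> - \<bar>x (2 * k - 1)\<bar> > 2 * s"
  shows "(Ek n k x xh)\<^sup>2 \<le> (\<Sum>i<2*k. (xh i - x i)\<^sup>2)"
proof -
  define x' where "x' = (\<lambda>i. if i < 2 * k then xh i else if i < n then x i else 0)"
  have s: "s \<ge> 0" using xh(2)[of 0] k by simp
  have "Hk n k xh = Hk n k x'"
  \<comment> \<open>This \<open>B\<close> separates the groups: estimates from index
    \<open>2 * k\<close> on stay below it up to equality, while the first \<open>k\<close> are at
    least \<open>\<bar>x (k - 1)\<bar> - s\<close>, which the gap puts above it.\<close>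
  proof (rule Hk_cong[where m = "2 * k" and B = "\<bar>x (2 * k - 1)\<bar> + s"])
    fix i assume i: "i < k"
    have "\<bar>x (k - 1)\<bar> \<le> \<bar>x i\<bar>" using i k by (intro sorted) auto
    moreover have "\<bar>x i\<bar> \<le> \<bar>xh i\<bar> + \<bar>xh i - x i\<bar>" by linarith
    moreover have "\<bar>xh i - x i\<bar> \<le> s" using i k by (intro xh(2)) auto
    ultimately show "\<bar>x (2 * k - 1)\<bar> + s < \<bar>xh i\<bar>" using gap by linarith
  next
    fix i assume i: "2 * k \<le> i" "i < n"
    then have "\<bar>x i\<bar> \<le> \<bar>x (2 * k - 1)\<bar>" by (intro sorted) auto
    then show "\<bar>xh i\<bar> \<le> \<bar>x (2 * k - 1)\<bar> + s \<and> \<bar>x' i\<bar> \<le> \<bar>x (2 * k - 1)\<bar> + s"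
      using xh(2)[of i] i s by (auto simp: x'_def)
  qed (use k in \<open>auto simp: x'_def\<close>)
  then have "(Ek n k x xh)\<^sup>2 \<le> (\<Sum>i<n. (x i - x' i)\<^sup>2)"
    using k by (intro Ek_square_le) (auto simp: x'_def)
  also have "\<dots> = (\<Sum>i<2*k. (xh i - x i)\<^sup>2)"
    using k by (intro sum.mono_neutral_cong_right) (auto simp: x'_def power2_commute)
  finally show ?thesis .
qed

section \<open>Tail bound for the top-k error\<close>

text \<open>For \<open>q\<close> close to ln k the collision term is of order k^(1/80 - 1) up to
  logarithmic factors, while its bound decays only like k^(-1/1600). The other two conditions
  compare powers of ln k with k.\<close>

lemma failure_bounds_eventually:
  fixes m :: real
  assumes "m > 0"
  obtains k0 :: nat where "k0 \<ge> 3"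
    "\<And>k q C. k \<ge> k0 \<Longrightarrow> q = nat \<lceil>ln (real k)\<rceil> \<Longrightarrow> k \<le> C \<Longrightarrow>
      2 * q \<le> C \<and> (real q)\<^sup>2 / real C * (1 + real q * exp (real q / 80)) \<le> exp (- real q / 1600) / 2 \<and>
      real q * (m * ln (real k) + 1) \<le> real C / 2"
proof -
  have "eventually (\<lambda>k :: nat. 2 * (ln (real k) + 1) \<le> real k) at_top" by real_asymp
  moreover have "eventually (\<lambda>k :: nat. (ln (real k) + 1)\<^sup>2 / real k * (1 + (ln (real k) + 1) * exp ((ln (real k) + 1) / 80))
      \<le> exp (- (ln (real k) + 1) / 1600) / 2) at_top" by real_asymp
  moreover have "eventually (\<lambda>k :: nat. (ln (real k) + 1) * (m * ln (real k) + 1) \<le> real k / 2) at_top"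
    using assms by real_asymp
  moreover have "eventually (\<lambda>k :: nat. k \<ge> 3) at_top" by (rule eventually_ge_at_top)
  ultimately have "eventually (\<lambda>k :: nat. 2 * (ln (real k) + 1) \<le> real k \<and>
      (ln (real k) + 1)\<^sup>2 / real k * (1 + (ln (real k) + 1) * exp ((ln (real k) + 1) / 80)) \<le> exp (- (ln (real k) + 1) / 1600) / 2 \<and>
      (ln (real k) + 1) * (m * ln (real k) + 1) \<le> real k / 2 \<and> k \<ge> 3) at_top"
    by eventually_elim auto
  then obtain k0 :: nat where k0: "\<And>k. k \<ge> k0 \<Longrightarrow> 2 * (ln (real k) + 1) \<le> real k \<and>
      (ln (real k) + 1)\<^sup>2 / real k * (1 + (ln (real k) + 1) * exp ((ln (real k) + 1) / 80)) \<le> exp (- (ln (real k) + 1) / 1600) / 2 \<and>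
      (ln (real k) + 1) * (m * ln (real k) + 1) \<le> real k / 2 \<and> k \<ge> 3"
    by (auto simp: eventually_at_top_linorder)
  show ?thesis
  proof (rule that[of "max k0 3"])
    fix k q C :: nat
    assume k: "max k0 3 \<le> k" and q: "q = nat \<lceil>ln (real k)\<rceil>" and C: "k \<le> C"
    define l where "l = ln (real k) + 1"
    have K: "2 * l \<le> real k" "l\<^sup>2 / real k * (1 + l * exp (l / 80)) \<le> exp (- l / 1600) / 2"
      "l * (m * ln (real k) + 1) \<le> real k / 2"
      using k0[of k] k unfolding l_def by auto
    have ln: "ln (real k) \<ge> 0" using k by simp
    then have ql: "real q \<le> l" "l \<ge> 0" unfolding q l_def by linarith+
    have Ck: "real k \<le> real C" "0 < real k" using C k by auto
    \<comment> \<open>All left sides grow with \<open>q\<close> and the slack grows with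
      \<open>C\<close>, so the estimates at \<open>l\<close> and \<open>k\<close> cover every
      admissible \<open>q\<close> and \<open>C\<close>.\<close>
    have "2 * real q \<le> real C" using ql(1) K(1) Ck(1) by linarith
    then have 1: "2 * q \<le> C" by linarith
    have "(real q)\<^sup>2 / real C \<le> l\<^sup>2 / real k"
      using ql Ck by (intro frac_le power_mono) auto
    moreover have "real q * exp (real q / 80) \<le> l * exp (l / 80)"
      using ql by (intro mult_mono) auto
    ultimately have "(real q)\<^sup>2 / real C * (1 + real q * exp (real q / 80)) \<le> l\<^sup>2 / real k * (1 + l * exp (l / 80))"
      by (intro mult_mono) auto
    also have "\<dots> \<le> exp (- l / 1600) / 2" by (rule K)
    also have "\<dots> \<le> exp (- real q / 1600) / 2" using ql by simp
    finally have 2: "(real q)\<^sup>2 / real C * (1 + real q * exp (real q / 80)) \<le> exp (- real q / 1600) / 2" .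
    have "real q * (m * ln (real k) + 1) \<le> l * (m * ln (real k) + 1)"
      using ql ln assms by (intro mult_right_mono) auto
    also have "\<dots> \<le> real C / 2" using K(3) Ck(1) by linarith
    finally have 3: "real q * (m * ln (real k) + 1) \<le> real C / 2" .
    show "2 * q \<le> C \<and> (real q)\<^sup>2 / real C * (1 + real q * exp (real q / 80)) \<le> exp (- real q / 1600) / 2 \<and>
      real q * (m * ln (real k) + 1) \<le> real C / 2"
      using 1 2 3 by blast
  qed simp
qed

text \<open>Markov for the sum of products over distinct \<open>q\<close>-tuples. On the event it is
  at least \<open>(C / 2) ^ q\<close>, the cap \<open>B\<close> ensuring that a few large terms
  cannot make up the total. Its mean is at most \<open>(2 * k) ^ q\<close> times the
  \<open>q\<close>-th power of the moment constant.\<close>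

lemma prob_level_sum_large:
  fixes x :: "nat \<Rightarrow> real"
  assumes k: "8 * k \<le> C" "k > 0" "2 * k \<le> n" and R: "R > 0" and q2: "2 * q \<le> C"
    and q: "(real q)\<^sup>2 / real C * (1 + real q * exp (real q / 80)) \<le> exp (- real q / 1600) / 2"
  defines "s \<equiv> l2norm n (tail_vec k x) / sqrt (real C)"
  defines "U \<equiv> \<lambda>\<omega> i. level_count R (real R * (row_est R n x \<omega> i - x i)\<^sup>2 / s\<^sup>2)"
  assumes s: "s > 0"
  assumes B: "real q * B \<le> real C / 2" "0 \<le> B"
  shows "measure_pmf.prob (rows_pmf R C n) {\<omega>. (\<forall>i<2*k. U \<omega> i \<le> B) \<and> real C \<le> (\<Sum>i<2*k. U \<omega> i)}
    \<le> (4 * (2 / (1 - exp (- 1 / 6400))) * real k / real C) ^ q"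
proof -
  let ?P = "rows_pmf R C n"
  define D :: real where "D = 2 / (1 - exp (- 1 / 6400))"
  have D: "D \<ge> 0" by (simp add: D_def)
  define L where "L = distinct_lists {..<2*k} q"
  define S where "S = real C / 2"
  have S: "S > 0" using k by (simp add: S_def)
  have finP: "finite (set_pmf ?P)" using k by simp
  have U0: "U \<omega> i \<ge> 0" for \<omega> i unfolding U_def level_count_def by (intro sum_nonneg) auto
  have "measure_pmf.prob ?P {\<omega>. (\<forall>i<2*k. U \<omega> i \<le> B) \<and> real C \<le> (\<Sum>i<2*k. U \<omega> i)}
    \<le> E ?P (\<lambda>\<omega>. 1 / S ^ q * (\<Sum>is\<in>L. \<Prod>i\<in>set is. U \<omega> i))"
  proof (intro prob_le_E finP)
    fix \<omega> assume "\<omega> \<in> {\<omega>. (\<forall>i<2*k. U \<omega> i \<le> B) \<and> real C \<le> (\<Sum>i<2*k. U \<omega> i)}"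
    then have "S ^ q \<le> (\<Sum>is\<in>L. \<Prod>i\<in>set is. U \<omega> i)"
      unfolding L_def using B U0 S by (intro sum_distinct_lists_ge[where B = B]) (auto simp: S_def)
    then show "1 \<le> 1 / S ^ q * (\<Sum>is\<in>L. \<Prod>i\<in>set is. U \<omega> i)" using S by (simp add: field_simps)
  qed (use S U0 in \<open>auto intro!: divide_nonneg_nonneg sum_nonneg prod_nonneg\<close>)
  also have "\<dots> = 1 / S ^ q * (\<Sum>is\<in>L. E ?P (\<lambda>\<omega>. \<Prod>i\<in>set is. U \<omega> i))"
    by (simp add: E_finite_sum[OF finP])
  also have "\<dots> \<le> 1 / S ^ q * (\<Sum>is\<in>L. D ^ q)"
  proof (intro mult_left_mono sum_mono)
    fix "is" assume "is": "is \<in> L"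
    then have c: "card (set is) = q" "set is \<subseteq> {..<n}"
      using k by (auto simp: L_def distinct_lists_def distinct_card)
    have "E ?P (\<lambda>\<omega>. \<Prod>i\<in>set is. U \<omega> i) \<le> (2 / (1 - exp (- 1 / 6400))) ^ card (set is)"
      unfolding U_def s_def using c k R q q2 s
      by (intro E_prod_level_count[where q = q and k = k]) (auto simp: s_def)
    then show "E ?P (\<lambda>\<omega>. \<Prod>i\<in>set is. U \<omega> i) \<le> D ^ q" by (simp add: D_def c)
  qed (use S in auto)
  also have "\<dots> = 1 / S ^ q * (real (card L) * D ^ q)" by simp
  also have "\<dots> \<le> 1 / S ^ q * (real (2 * k) ^ q * D ^ q)"
  proof -
    have "card L \<le> (2 * k) ^ q" unfolding L_def using card_distinct_lists_le[of "{..<2*k}" q] by simp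
    then have "real (card L) \<le> real (2 * k) ^ q" by (metis of_nat_le_iff of_nat_power)
    then show ?thesis using S D by (intro mult_left_mono mult_right_mono) auto
  qed
  also have "\<dots> = (real (2 * k) * D / S) ^ q"
    by (simp only: power_mult_distrib power_divide times_divide_eq_left mult_1_left)
  also have "real (2 * k) * D / S = 4 * D * real k / real C" by (simp add: S_def)
  finally show ?thesis by (simp add: D_def)
qed

theorem theorem7p1:
  fixes a d :: real
  assumes "a > 0" and "d > 0"
  shows "\<exists>b c K :: real. b > 0 \<and> c > 0 \<and> K > 0 \<and>
    (\<forall>(n::nat) (k::nat) (x::nat \<Rightarrow> real) (R::nat).
       0 < k \<and> 2 * k \<le> n \<and>
       (\<forall>i j. i \<le> j \<and> j < n \<longrightarrow> \<bar>x j\<bar> \<le> \<bar>x i\<bar>) \<and>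
       \<bar>x (k - 1)\<bar> - \<bar>x (2 * k - 1)\<bar> \<ge> a * l2norm n (tail_vec k x) / sqrt (real k) \<and>
       real R \<ge> b * ln (real n)
       \<longrightarrow>
       measure_pmf.prob (hash_pmf R (nat \<lceil>c * real k\<rceil>) n)
         {(h, s). (Ek n k x (cs_estimate R n h s x))\<^sup>2
                    \<le> (l2norm n (tail_vec k x))\<^sup>2 / real R}
       \<ge> 1 - K / (real k powr d))"
proof -
  define D :: real where "D = 2 / (1 - exp (- 1 / 6400))"
  have D: "D > 0" by (simp add: D_def)
  \<comment> \<open>Chosen so that \<open>exp (- R / 6400)\<close> is at most n^(-(d+1)), which
    survives a union bound over n coordinates.\<close>
  define b where "b = 6400 * (d + 1)"
  \<comment> \<open>The three summands serve the small-ball estimate (\<open>8 * k \<le> C\<close>),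
    the comparison of the gap with twice the maximal error, and the ratio \<open>exp (- d)\<close>
    in the moment bound.\<close>
  define c where "c = 8 + 9 / a\<^sup>2 + 4 * D * exp d"
  have b: "b > 0" using assms by (simp add: b_def)
  have c: "c \<ge> 8" "c > 4 / a\<^sup>2" "c \<ge> 4 * D * exp d"
  proof -
    have "9 / a\<^sup>2 > 4 / a\<^sup>2" using assms by (simp add: divide_strict_right_mono)
    moreover have "4 / a\<^sup>2 > 0" "4 * D * exp d > 0" using assms D by auto
    ultimately show "c \<ge> 8" "c > 4 / a\<^sup>2" "c \<ge> 4 * D * exp d" unfolding c_def by linarith+
  qed
  obtain k0 :: nat where k0: "k0 \<ge> 3"
    "\<And>k q C. k \<ge> k0 \<Longrightarrow> q = nat \<lceil>ln (real k)\<rceil> \<Longrightarrow> k \<le> C \<Longrightarrow>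
      2 * q \<le> C \<and> (real q)\<^sup>2 / real C * (1 + real q * exp (real q / 80)) \<le> exp (- real q / 1600) / 2 \<and>
      real q * (b * ln (real k) + 1) \<le> real C / 2"
    using failure_bounds_eventually[OF b] by metis
  \<comment> \<open>The three bad events contribute 2 + 4 + 1 = 7; the other summand makes the claim
    trivial for \<open>k < k0\<close>.\<close>
  define K where "K = 7 + real k0 powr d"
  have K: "K > 0" "K \<ge> 7" by (auto simp: K_def add_pos_nonneg)
  show ?thesis
  proof (rule exI[of _ b], rule exI[of _ c], rule exI[of _ K], intro conjI allI impI)
    fix n k R :: nat and x :: "nat \<Rightarrow> real"
    assume "0 < k \<and> 2 * k \<le> n \<and> (\<forall>i j. i \<le> j \<and> j < n \<longrightarrow> \<bar>x j\<bar> \<le> \<bar>x i\<bar>) \<and>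
       \<bar>x (k - 1)\<bar> - \<bar>x (2 * k - 1)\<bar> \<ge> a * l2norm n (tail_vec k x) / sqrt (real k) \<and> real R \<ge> b * ln (real n)"
    then have k: "0 < k" "2 * k \<le> n" and sorted: "\<And>i j. i \<le> j \<Longrightarrow> j < n \<Longrightarrow> \<bar>x j\<bar> \<le> \<bar>x i\<bar>"
      and gap: "\<bar>x (k - 1)\<bar> - \<bar>x (2 * k - 1)\<bar> \<ge> a * l2norm n (tail_vec k x) / sqrt (real k)"
      and Rb: "real R \<ge> b * ln (real n)" by auto
    define C where "C = nat \<lceil>c * real k\<rceil>"
    define T where "T = l2norm n (tail_vec k x)"
    let ?G = "{(h, s). (Ek n k x (cs_estimate R n h s x))\<^sup>2 \<le> T\<^sup>2 / real R}"
    let ?P = "rows_pmf R C n"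
    have "1 - K / (real k powr d) \<le> measure_pmf.prob (hash_pmf R C n) ?G"
    proof (cases "k < k0")
      case True
      have "real k powr d \<le> real k0 powr d" using True assms k by (intro powr_mono2) auto
      then have "real k powr d \<le> K" by (simp add: K_def)
      then have "1 \<le> K / (real k powr d)" using k by simp
      then show ?thesis using measure_nonneg[of "measure_pmf (hash_pmf R C n)" ?G] by linarith
    next
      case False
      then have kk0: "k \<ge> k0" by simp
      define q where "q = nat \<lceil>ln (real k)\<rceil>"
      have Cc: "real C \<ge> c * real k" unfolding C_def by linarith
      have "8 * real k \<le> c * real k" using c by (intro mult_right_mono) auto
      then have "real (8 * k) \<le> real C" using Cc by simp
      then have C8: "8 * k \<le> C" by (simp only: of_nat_le_iff)
      have C: "C > 0" "k \<le> C" using C8 k by auto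
      have q: "2 * q \<le> C" "(real q)\<^sup>2 / real C * (1 + real q * exp (real q / 80)) \<le> exp (- real q / 1600) / 2"
        "real q * (b * ln (real k) + 1) \<le> real C / 2"
        using k0(2)[OF kk0 q_def C(2)] by auto
      have k3: "real k \<ge> 3" "n \<ge> 2" using kk0 k0(1) k by auto
      have lnk: "ln (real k) > 0" using k3 by simp
      have q1: "q \<ge> 1" "real q \<ge> ln (real k)" using lnk unfolding q_def by linarith+
      have "ln (real n) > 0" using k3 by simp
      then have R: "R > 0" using Rb b mult_pos_pos[of b "ln (real n)"] by linarith
      define s where "s = T / sqrt (real C)"
      have T0: "T \<ge> 0" by (simp add: T_def l2norm_def sum_nonneg)
      have s0: "s \<ge> 0" using T0 by (simp add: s_def)
      \<comment> \<open>Levels above \<open>b * ln k\<close> are unlikely for all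
        \<open>2 * k\<close> head errors together, which caps each count at
        \<open>L + 1\<close>.\<close>
      define L where "L = b * ln (real k)"
      have L0: "L \<ge> 0" using b lnk by (simp add: L_def)
      define err where "err = (\<lambda>\<omega> i. row_est R n x \<omega> i - x i)"
      define U where "U = (\<lambda>\<omega> i. level_count R (real R * (err \<omega> i)\<^sup>2 / s\<^sup>2))"
      have finP: "finite (set_pmf ?P)" using C by simp
      have single: "measure_pmf.prob ?P {\<omega>. \<bar>err \<omega> i\<bar> > t * s} \<le> 2 * exp (- real R * t\<^sup>2 / 6400)"
        if "i < n" "0 \<le> t" "t \<le> 1" for i t
        using joint_tail[of "{i}" n q C k R "\<lambda>_. t" x] that q C8 q1 k R
        by (simp add: err_def s_def T_def)
      \<comment> \<open>Outside \<open>B1\<close> the top entries are selected correctly and no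
        scaled error passes the cap \<open>R\<close>; outside \<open>B2\<close> every head count is
        at most \<open>L + 1\<close>; \<open>B3\<close> is the event of the moment bound.\<close>
      define B1 where "B1 = {\<omega>. \<exists>i<n. \<bar>err \<omega> i\<bar> > s}"
      define B2 where "B2 = {\<omega>. L \<le> real R \<and> (\<exists>i<2*k. \<bar>err \<omega> i\<bar> > sqrt (L / real R) * s)}"
      define B3 where "B3 = {\<omega>. s > 0 \<and> (\<forall>i<2*k. U \<omega> i \<le> L + 1) \<and> real C \<le> (\<Sum>i<2*k. U \<omega> i)}"
      have pd: "real k powr d > 0" using k by simp
      have P1: "measure_pmf.prob ?P B1 \<le> 2 / real k powr d"
      proof -
        have "B1 = (\<Union>i\<in>{..<n}. {\<omega>. \<bar>err \<omega> i\<bar> > 1 * s})" by (auto simp: B1_def)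
        then have "measure_pmf.prob ?P B1 \<le> (\<Sum>i<n. measure_pmf.prob ?P {\<omega>. \<bar>err \<omega> i\<bar> > 1 * s})"
          by (simp only:) (rule measure_pmf.finite_measure_subadditive_finite; simp)
        also have "\<dots> \<le> (\<Sum>i<n. 2 * exp (- real R * 1\<^sup>2 / 6400))" by (intro sum_mono single) auto
        also have "\<dots> = 2 * (real n * exp (- real R / 6400))" by simp
        also have "\<dots> \<le> 2 * (real n * exp (- (d + 1) * ln (real n)))"
        proof -
          have "b * ln (real n) = 6400 * ((d + 1) * ln (real n))" by (simp add: b_def)
          then have "- real R / 6400 \<le> - ((d + 1) * ln (real n))" using Rb by linarith
          then show ?thesis by (intro mult_left_mono) (auto simp: algebra_simps)
        qed
        also have "\<dots> = 2 * real n powr (- d)"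
        proof -
          have "real n * exp (- (d + 1) * ln (real n)) = exp (ln (real n)) * exp (- (d + 1) * ln (real n))"
            using k3 by simp
          also have "\<dots> = exp (- d * ln (real n))" unfolding exp_add[symmetric] by (simp add: algebra_simps)
          finally show ?thesis using k3 by (simp add: powr_def)
        qed
        also have "\<dots> \<le> 2 * real k powr (- d)"
          using k assms by (intro mult_left_mono powr_mono2') auto
        finally show ?thesis by (simp add: powr_minus divide_inverse)
      qed
      \<comment> \<open>For \<open>L > R\<close> the event is empty, since a count never exceeds
        \<open>R\<close>. Otherwise \<open>R\<close> cancels in the tail bound at
        \<open>t = sqrt (L / R)\<close>.\<close>
      have P2: "measure_pmf.prob ?P B2 \<le> 4 / real k powr d"
      proof (cases "L \<le> real R")
        case True
        have "B2 = (\<Union>i\<in>{..<2*k}. {\<omega>. \<bar>err \<omega> i\<bar> > sqrt (L / real R) * s})" using True by (auto simp: B2_def)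
        then have "measure_pmf.prob ?P B2 \<le> (\<Sum>i<2*k. measure_pmf.prob ?P {\<omega>. \<bar>err \<omega> i\<bar> > sqrt (L / real R) * s})"
          by (simp only:) (rule measure_pmf.finite_measure_subadditive_finite; simp)
        also have "\<dots> \<le> (\<Sum>i<2*k. 2 * exp (- real R * (sqrt (L / real R))\<^sup>2 / 6400))"
          using k True L0 R by (intro sum_mono single) auto
        also have "\<dots> = 4 * (real k * exp (- L / 6400))" using L0 R by simp
        also have "real k * exp (- L / 6400) = exp (ln (real k)) * exp (- (d + 1) * ln (real k))"
        proof -
          have "- L / 6400 = - (d + 1) * ln (real k)" by (simp add: L_def b_def field_simps)
          then show ?thesis using k by simp
        qed
        also have "\<dots> = exp (- d * ln (real k))" unfolding exp_add[symmetric] by (simp add: algebra_simps)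
        also have "\<dots> = real k powr (- d)" using k by (simp add: powr_def)
        finally show ?thesis by (simp add: powr_minus divide_inverse)
      qed (auto simp: B2_def)
      have P3: "measure_pmf.prob ?P B3 \<le> 1 / real k powr d"
      proof (cases "s > 0")
        case True
        have "measure_pmf.prob ?P B3 \<le> (4 * D * real k / real C) ^ q"
        proof -
          have "B3 = {\<omega>. (\<forall>i<2*k. level_count R (real R * (row_est R n x \<omega> i - x i)\<^sup>2 / s\<^sup>2) \<le> L + 1) \<and>
              real C \<le> (\<Sum>i<2*k. level_count R (real R * (row_est R n x \<omega> i - x i)\<^sup>2 / s\<^sup>2))}"
            using True by (simp only: B3_def U_def err_def simp_thms)
          moreover have "real q * (L + 1) \<le> real C / 2" "0 \<le> L + 1" using q(3) L0 by (simp_all add: L_def)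
          ultimately show ?thesis
            using prob_level_sum_large[OF C8 k(1) k(2) R q(1) q(2), of x "L + 1", folded T_def, folded s_def, folded D_def] True
            by (simp only:)
        qed
        \<comment> \<open>The choice of \<open>c\<close> makes the ratio at most
          \<open>exp (- d)\<close>, and \<open>q \<ge> ln k\<close> turns its \<open>q\<close>-th
          power into at most k^(-d).\<close>
        also have "\<dots> \<le> (exp (- d)) ^ q"
        proof (intro power_mono)
          have "4 * D * exp d * real k \<le> real C" using c(3) Cc mult_right_mono[of "4 * D * exp d" c "real k"] by simp
          then have "4 * D * real k * exp d \<le> real C" by (simp add: mult_ac)
          then show "4 * D * real k / real C \<le> exp (- d)" using C by (simp add: exp_minus field_simps)
        qed (use D in auto)
        also have "\<dots> = exp (- d * real q)" by (simp add: exp_of_nat_mult[symmetric] mult.commute)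
        also have "\<dots> \<le> exp (- d * ln (real k))" using q1 assms by simp
        also have "\<dots> = real k powr (- d)" using k by (simp add: powr_def)
        finally show ?thesis by (simp add: powr_minus divide_inverse)
      qed (auto simp: B3_def)
      define f where "f = (\<lambda>\<omega> :: nat \<Rightarrow> nat \<Rightarrow> nat \<times> real. (\<lambda>u i. fst (\<omega> u i), \<lambda>u i. snd (\<omega> u i)))"
      have good: "(Ek n k x (cs_estimate R n (\<lambda>u i. fst (\<omega> u i)) (\<lambda>u i. snd (\<omega> u i)) x))\<^sup>2 \<le> T\<^sup>2 / real R"
        if \<omega>: "\<omega> \<in> set_pmf ?P" "\<omega> \<notin> B1" "\<omega> \<notin> B2" "\<omega> \<notin> B3" for \<omega>
      proof -
        define xh where "xh = cs_estimate R n (\<lambda>u i. fst (\<omega> u i)) (\<lambda>u i. snd (\<omega> u i)) x"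
        have xh: "xh i = 0" if "i \<ge> n" for i using that by (simp add: xh_def cs_estimate_def)
        have xherr: "xh i - x i = err \<omega> i" if "i < n" for i
          unfolding xh_def err_def using cs_estimate_eq_row_est[OF \<omega>(1) C(1) that] by simp
        have small: "\<bar>err \<omega> i\<bar> \<le> s" if "i < n" for i
        proof -
          have "\<not> s < \<bar>err \<omega> i\<bar>" using \<omega>(2) that unfolding B1_def by blast
          then show ?thesis by simp
        qed
        have "(Ek n k x xh)\<^sup>2 \<le> T\<^sup>2 / real R"
        proof (cases "T = 0")
          case True
          \<comment> \<open>A vanishing tail leaves no noise scale, so outside \<open>B1\<close>
            every estimate is exact.\<close>
          then have "s = 0" by (simp add: s_def)
          then have "xh i = x i" if "i < n" for i using small[OF that] xherr[OF that] by simp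
          then have "(\<Sum>i<n. (x i - xh i)\<^sup>2) = 0" by simp
          then show ?thesis using Ek_square_le[of n xh k xh x] xh True by simp
        next
          case False
          then have Tp: "T > 0" using T0 by simp
          then have sp: "s > 0" using C by (simp add: s_def)
          have "2 * s < a * T / sqrt (real k)"
          proof -
            \<comment> \<open>\<open>c > 4 / a\<^sup>2\<close> gives
              \<open>4 * k < a\<^sup>2 * C\<close>; square roots then compare twice the maximal
              error with the gap.\<close>
            have "4 * real k < a\<^sup>2 * (c * real k)" using c(2) assms k by (simp add: field_simps)
            also have "\<dots> \<le> a\<^sup>2 * real C" using Cc by (intro mult_left_mono) auto
            finally have "sqrt (4 * real k) < sqrt (a\<^sup>2 * real C)" by simp
            then have "2 * sqrt (real k) < a * sqrt (real C)" using assms by (simp add: real_sqrt_mult)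
            then have "2 / sqrt (real C) < a / sqrt (real k)" using C k by (simp add: field_simps)
            then have "2 / sqrt (real C) * T < a / sqrt (real k) * T" using Tp by (rule mult_strict_right_mono)
            then show ?thesis by (simp add: s_def)
          qed
          then have gap': "\<bar>x (k - 1)\<bar> - \<bar>x (2 * k - 1)\<bar> > 2 * s" using gap by (simp add: T_def)
          have "(Ek n k x xh)\<^sup>2 \<le> (\<Sum>i<2*k. (xh i - x i)\<^sup>2)"
            using k sorted xh gap' small xherr by (intro Ek_square_le_head[where s = s]) auto
          also have "\<dots> = (\<Sum>i<2*k. (err \<omega> i)\<^sup>2)" using xherr k by (intro sum.cong) auto
          also have "\<dots> \<le> T\<^sup>2 / real R"
          proof (rule ccontr)
            assume "\<not> (\<Sum>i<2*k. (err \<omega> i)\<^sup>2) \<le> T\<^sup>2 / real R"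
            then have big: "T\<^sup>2 / real R \<le> (\<Sum>i<2*k. (err \<omega> i)\<^sup>2)" by simp
            \<comment> \<open>In units of \<open>s\<^sup>2 / R\<close> the permitted error
              \<open>T\<^sup>2 / R\<close> equals \<open>C\<close>, so a larger error forces the
              level counts to sum to at least \<open>C\<close>.\<close>
            have "real C = real R / s\<^sup>2 * (T\<^sup>2 / real R)"
              using Tp C R by (simp add: s_def power_divide)
            also have "\<dots> \<le> real R / s\<^sup>2 * (\<Sum>i<2*k. (err \<omega> i)\<^sup>2)" using big by (intro mult_left_mono) auto
            also have "\<dots> = (\<Sum>i<2*k. real R * (err \<omega> i)\<^sup>2 / s\<^sup>2)" by (simp add: sum_distrib_left)
            also have "\<dots> \<le> (\<Sum>i<2*k. U \<omega> i)"
              unfolding U_def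
            proof (intro sum_mono level_count_ge)
              fix i assume "i \<in> {..<2*k}"
              then have "\<bar>err \<omega> i\<bar>\<^sup>2 \<le> s\<^sup>2" using small[of i] k by (intro power_mono) auto
              then have "real R * (err \<omega> i)\<^sup>2 \<le> real R * s\<^sup>2" by (intro mult_left_mono) auto
              then show "real R * (err \<omega> i)\<^sup>2 / s\<^sup>2 \<le> real R" using sp by (simp add: field_simps)
            qed
            finally have "real C \<le> (\<Sum>i<2*k. U \<omega> i)" .
            moreover have "U \<omega> i \<le> L + 1" if "i < 2 * k" for i
              unfolding U_def
            proof (intro level_count_le L0)
              show "real R * (err \<omega> i)\<^sup>2 / s\<^sup>2 \<le> L \<or> real R \<le> L"
              proof (cases "L \<le> real R")
                case True
                then have "\<not> sqrt (L / real R) * s < \<bar>err \<omega> i\<bar>" using \<omega>(3) that unfolding B2_def by blast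
                then have "\<bar>err \<omega> i\<bar> \<le> sqrt (L / real R) * s" by simp
                then have "\<bar>err \<omega> i\<bar>\<^sup>2 \<le> (sqrt (L / real R) * s)\<^sup>2" by (intro power_mono) auto
                then have "(err \<omega> i)\<^sup>2 \<le> L / real R * s\<^sup>2" using L0 by (simp add: power_mult_distrib)
                then show ?thesis using R sp by (simp add: field_simps)
              qed auto
            qed
            ultimately have "\<omega> \<in> B3" using sp by (auto simp: B3_def)
            then show False using \<omega>(4) by simp
          qed
          finally show ?thesis .
        qed
        then show ?thesis by (simp add: xh_def)
      qed
      have "1 - measure_pmf.prob (hash_pmf R C n) ?G = 1 - measure_pmf.prob ?P (f -` ?G)"
        using C by (simp add: hash_pmf_eq_rows f_def)
      also have "\<dots> = measure_pmf.prob ?P (- (f -` ?G))"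
        using measure_pmf.prob_compl[of "f -` ?G" ?P] by (simp add: Compl_eq_Diff_UNIV)
      also have "\<dots> \<le> E ?P (\<lambda>\<omega>. of_bool (\<omega> \<in> B1) + of_bool (\<omega> \<in> B2) + of_bool (\<omega> \<in> B3))"
        using good by (intro prob_le_E finP) (auto simp: f_def)
      also have "\<dots> = measure_pmf.prob ?P {\<omega>. \<omega> \<in> B1} + measure_pmf.prob ?P {\<omega>. \<omega> \<in> B2} + measure_pmf.prob ?P {\<omega>. \<omega> \<in> B3}"
        by (simp only: E_finite_add[OF finP] prob_eq_E)
      also have "\<dots> \<le> 2 / real k powr d + 4 / real k powr d + 1 / real k powr d"
        using P1 P2 P3 by simp
      also have "\<dots> = 7 / real k powr d" by (simp add: field_simps)
      also have "\<dots> \<le> K / real k powr d" using K pd by (intro divide_right_mono) auto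
      finally show ?thesis by simp
    qed
    then show "measure_pmf.prob (hash_pmf R (nat \<lceil>c * real k\<rceil>) n)
         {(h, s). (Ek n k x (cs_estimate R n h s x))\<^sup>2 \<le> (l2norm n (tail_vec k x))\<^sup>2 / real R}
       \<ge> 1 - K / (real k powr d)"
      by (simp add: C_def T_def)
  qed (use b c K in auto)
qed

end
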